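(* Let $n\ge2$ and let $0=\alpha_0<\alpha_1<\cdots<\alpha_{2n-1}<2\pi$ be distinct; put $\alpha_{2n}:=2\pi$. Let $f$ be the Kobayashi surface of principal type with angular data $(\alpha_0,\dots,\alpha_{2n-1})$, i.e. the maxface associated to $$g=z^{n-1},\qquad \omega=\frac{\mathrm{i}\Lambda\,dz}{\prod_{j=0}^{2n-1}(z-e^{\mathrm{i}\alpha_j})},\qquad \Lambda=\exp\left(\mathrm{i}\,\frac{\alpha_0+\cdots+\alpha_{2n-1}}2\right).$$ Suppose that $$|\alpha_j-\alpha_{j+1}|<\frac{2\pi}{n-1}\qquad(j=0,\dots,2n-1).$$ Then its analytic extension $\tilde f:\Omega_{\alpha_0,\dots,\alpha_{2n-1}}\to\mathbb{R}^3_1$ is a proper immersion.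
   Context: $\mathbb{R}^3_1$ is Lorentz–Minkowski 3-space with signature $(-,+,+)$; $S^2=\mathbb{C}\cup\{\infty\}$; $\mathrm{i}=\sqrt{-1}$. The maxface associated to $(g,\omega)$ is $f=\mathrm{Re}\int(-2g,1+g^2,\mathrm{i}(1-g^2))\omega$, which here is single-valued on $S^2\setminus\{e^{\mathrm{i}\alpha_0},\dots,e^{\mathrm{i}\alpha_{2n-1}}\}$ and satisfies $f(1/\bar z)=f(z)$. Domain of the analytic extension: $$\Omega_{\alpha_0,\dots,\alpha_{2n-1}}=\left\{(u,\theta)\in\mathbb{R}\times\mathbb{R}/2\pi\mathbb{Z}: u>\max_{j}\cos(\theta-\alpha_j)\right\}\cup\{p_\infty\},$$ a real analytic 2-manifold with coordinates $(u,\theta)$ away from $p_\infty$ and, near $p_\infty$, with coordinate $z=re^{\mathrm{i}\theta}$ in a disk about $0$, where $r=u-\sqrt{u^2-1}$ and $p_\infty$ corresponds to $z=0$. Let $\iota(re^{\mathrm{i}\theta})=\left(\frac{r+r^{-1}}2,\theta\right)$ for $0<r\le1$ and $\iota(0)=p_\infty$. The analytic extension $\tilde f$ of $f$ is the (unique) real analytic map on $\Omega_{\alpha_0,\dots,\alpha_{2n-1}}$ with $\tilde f\circ\iota=f$ on $\{|z|\le1\}\setminus\{e^{\mathrm{i}\alpha_j}\}$. *)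

theory Defs
  imports "HOL-Complex_Analysis.Complex_Analysis"
begin

section \<open>Maxfaces on the Riemann sphere\<close>

datatype riemann_sphere = Fin complex | Infty

text \<open>
  Minkowski 3-space is modelled by \<open>real^3\<close>, the first coordinate being the timelike one; the
  indefinite metric itself enters neither properness nor immersivity. A one-form \<open>\<omega> = h dz\<close> is
  represented by its coefficient \<open>h\<close>.
\<close>

definition weierstrass_form :: "(complex \<Rightarrow> complex) \<Rightarrow> (complex \<Rightarrow> complex) \<Rightarrow> complex \<Rightarrow> complex^3"
  where "weierstrass_form g h z =
    vector [- 2 * g z * h z, (1 + (g z)\<^sup>2) * h z, \<i> * (1 - (g z)\<^sup>2) * h z]"

definition Re_form :: "complex^3 \<Rightarrow> complex \<Rightarrow> real^3"
  where "Re_form v dz = (\<chi> k. Re (v $ k * dz))"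

text \<open>
  \<open>f = Re \<integral> (-2g, 1 + g\<^sup>2, \<i>(1 - g\<^sup>2)) \<omega>\<close> on the sphere minus \<open>P\<close>, which determines \<open>f\<close>
  there up to a translation: \<open>f\<close> is a primitive of the real part of the vector-valued form. Near
  infinity this is said in the coordinate \<open>w = 1/z\<close>, where \<open>dz = - dw / w\<^sup>2\<close>; \<open>\<psi>\<close> is the
  holomorphic continuation of the coefficient to \<open>w = 0\<close>. Values of \<open>f\<close> on \<open>P\<close> are arbitrary.
\<close>

definition maxface_on_sphere ::
  "(complex \<Rightarrow> complex) \<Rightarrow> (complex \<Rightarrow> complex) \<Rightarrow> complex set \<Rightarrow> (riemann_sphere \<Rightarrow> real^3) \<Rightarrow> bool"
  where "maxface_on_sphere g h P f \<longleftrightarrow>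
    (\<forall>z. z \<notin> P \<longrightarrow>
      ((\<lambda>z. f (Fin z)) has_derivative Re_form (weierstrass_form g h z)) (at z)) \<and>
    (\<exists>\<psi> :: complex \<Rightarrow> complex^3. \<exists>\<epsilon>>0.
      (\<forall>k. (\<lambda>w. \<psi> w $ k) holomorphic_on ball 0 \<epsilon>) \<and>
      (\<forall>w\<in>ball 0 \<epsilon> - {0}. \<psi> w = (- 1 / w\<^sup>2) *s weierstrass_form g h (1 / w)) \<and>
      (\<forall>w\<in>ball 0 \<epsilon>.
        ((\<lambda>w. f (if w = 0 then Infty else Fin (1 / w))) has_derivative Re_form (\<psi> w)) (at w)))"


section \<open>Kobayashi surfaces of principal type\<close>

definition kob_ends :: "nat \<Rightarrow> (nat \<Rightarrow> real) \<Rightarrow> complex set"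
  where "kob_ends n \<alpha> = (\<lambda>j. cis (\<alpha> j)) ` {..<2 * n}"

definition kob_g :: "nat \<Rightarrow> complex \<Rightarrow> complex"
  where "kob_g n z = z ^ (n - 1)"

definition kob_Lambda :: "nat \<Rightarrow> (nat \<Rightarrow> real) \<Rightarrow> complex"
  where "kob_Lambda n \<alpha> = exp (\<i> * of_real ((\<Sum>j<2 * n. \<alpha> j) / 2))"

definition kob_omega :: "nat \<Rightarrow> (nat \<Rightarrow> real) \<Rightarrow> complex \<Rightarrow> complex"
  where "kob_omega n \<alpha> z = \<i> * kob_Lambda n \<alpha> / (\<Prod>j<2 * n. z - cis (\<alpha> j))"

definition kobayashi_surface :: "nat \<Rightarrow> (nat \<Rightarrow> real) \<Rightarrow> (riemann_sphere \<Rightarrow> real^3) \<Rightarrow> bool"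
  where "kobayashi_surface n \<alpha> f \<longleftrightarrow>
    maxface_on_sphere (kob_g n) (kob_omega n \<alpha>) (kob_ends n \<alpha>) f"


section \<open>The domain of the analytic extension\<close>

text \<open>The circle of angles, the quotient of the reals by the integer multiples of \<open>2 * pi\<close>.\<close>

quotient_type angle = real / "\<lambda>x y. \<exists>k::int. x - y = 2 * pi * of_int k"
  morphisms angle_rep angle_of
proof (rule equivpI)
  show "reflp (\<lambda>x y. \<exists>k::int. x - y = 2 * pi * of_int k)"
    by (rule reflpI, rule exI[of _ 0], simp)
  show "symp (\<lambda>x y. \<exists>k::int. x - y = 2 * pi * of_int k)"
  proof (rule sympI, elim exE)
    fix x y :: real and k :: int
    assume "x - y = 2 * pi * of_int k"
    then show "\<exists>k::int. y - x = 2 * pi * of_int k"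
      by (intro exI[of _ "- k"]) (simp add: algebra_simps)
  qed
  show "transp (\<lambda>x y. \<exists>k::int. x - y = 2 * pi * of_int k)"
  proof (rule transpI, elim exE)
    fix x y z :: real and k l :: int
    assume "x - y = 2 * pi * of_int k" "y - z = 2 * pi * of_int l"
    then show "\<exists>k::int. x - z = 2 * pi * of_int k"
      by (intro exI[of _ "k + l"]) (simp add: algebra_simps)
  qed
qed

datatype ext_point = Pt real angle | P_inf

definition Omega :: "nat \<Rightarrow> (nat \<Rightarrow> real) \<Rightarrow> ext_point set"
  where "Omega n \<alpha> =
    {Pt u (angle_of \<theta>) | u \<theta>. u > Max ((\<lambda>j. cos (\<theta> - \<alpha> j)) ` {..<2 * n})} \<union> {P_inf}"

definition iota :: "complex \<Rightarrow> ext_point"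
  where "iota z =
    (if z = 0 then P_inf else Pt ((cmod z + inverse (cmod z)) / 2) (angle_of (Arg z)))"

text \<open>
  The two (inverse) charts, with domains in the plane. The first one is \<open>2 * pi\<close>-periodic in the
  angle, so it is a local parametrisation. The second one is \<open>iota\<close> on the open unit disk; its
  image is \<open>P_inf\<close> together with all points with \<open>u > 1\<close>, and its inverse is
  \<open>r = u - sqrt (u\<^sup>2 - 1)\<close>.
\<close>

definition chart_fin :: "real \<times> real \<Rightarrow> ext_point"
  where "chart_fin = (\<lambda>(u, \<theta>). Pt u (angle_of \<theta>))"

definition dom_fin :: "nat \<Rightarrow> (nat \<Rightarrow> real) \<Rightarrow> (real \<times> real) set"
  where "dom_fin n \<alpha> = {p. chart_fin p \<in> Omega n \<alpha>}"

definition chart_inf :: "real \<times> real \<Rightarrow> ext_point"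
  where "chart_inf = (\<lambda>(x, y). iota (Complex x y))"

definition dom_inf :: "(real \<times> real) set"
  where "dom_inf = ball 0 1"

definition Omega_openin :: "nat \<Rightarrow> (nat \<Rightarrow> real) \<Rightarrow> ext_point set \<Rightarrow> bool"
  where "Omega_openin n \<alpha> U \<longleftrightarrow>
    U \<subseteq> Omega n \<alpha> \<and> open {p \<in> dom_fin n \<alpha>. chart_fin p \<in> U} \<and>
    open {p \<in> dom_inf. chart_inf p \<in> U}"

definition Omega_top :: "nat \<Rightarrow> (nat \<Rightarrow> real) \<Rightarrow> ext_point topology"
  where "Omega_top n \<alpha> = topology (Omega_openin n \<alpha>)"

lemma istopology_Omega_openin: "istopology (Omega_openin n \<alpha>)"
  unfolding istopology_def
proof (intro conjI allI impI)
  fix S T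
  assume S: "Omega_openin n \<alpha> S" and T: "Omega_openin n \<alpha> T"
  have "{p \<in> D. c p \<in> S \<inter> T} = {p \<in> D. c p \<in> S} \<inter> {p \<in> D. c p \<in> T}"
    for D and c :: "real \<times> real \<Rightarrow> ext_point"
    by auto
  with S T show "Omega_openin n \<alpha> (S \<inter> T)"
    by (auto simp: Omega_openin_def intro: open_Int)
next
  fix \<K>
  assume K: "\<forall>K\<in>\<K>. Omega_openin n \<alpha> K"
  have "{p \<in> D. c p \<in> \<Union>\<K>} = (\<Union>K\<in>\<K>. {p \<in> D. c p \<in> K})"
    for D and c :: "real \<times> real \<Rightarrow> ext_point"
    by auto
  with K show "Omega_openin n \<alpha> (\<Union>\<K>)"
    by (auto simp: Omega_openin_def intro!: open_UN)
qed

lemma openin_Omega_top: "openin (Omega_top n \<alpha>) = Omega_openin n \<alpha>"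
  by (simp add: Omega_top_def istopology_Omega_openin topology_inverse')

lemma dom_fin_eq:
  "dom_fin n \<alpha> = {(u, \<theta>). u > Max ((\<lambda>j. cos (\<theta> - \<alpha> j)) ` {..<2 * n})}"
proof -
  have "cos (\<theta> - a) = cos (\<theta>' - a)" if "angle_of \<theta> = angle_of \<theta>'" for \<theta> \<theta>' a
  proof -
    from that obtain k :: int where "\<theta> - \<theta>' = 2 * pi * of_int k"
      by (auto simp: angle.abs_eq_iff)
    then have "\<theta> - a = (\<theta>' - a) + 2 * pi * of_int k"
      by simp
    then have "cos (\<theta> - a) = cos (\<theta>' - a + 2 * pi * of_int k)"
      by (rule arg_cong)
    then show ?thesis
      by (simp only: cos_add sin_int_2pin cos_int_2pin)
  qed
  then have M: "Max ((\<lambda>j. cos (\<theta> - \<alpha> j)) ` {..<2 * n}) = Max ((\<lambda>j. cos (\<theta>' - \<alpha> j)) ` {..<2 * n})"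
    if "angle_of \<theta> = angle_of \<theta>'" for \<theta> \<theta>'
    using that by (intro arg_cong[where f = Max] image_cong refl)
  have "Pt u (angle_of \<theta>) \<in> Omega n \<alpha> \<longleftrightarrow> u > Max ((\<lambda>j. cos (\<theta> - \<alpha> j)) ` {..<2 * n})" for u \<theta>
  proof
    assume "Pt u (angle_of \<theta>) \<in> Omega n \<alpha>"
    then obtain \<theta>' where "angle_of \<theta> = angle_of \<theta>'"
      and "u > Max ((\<lambda>j. cos (\<theta>' - \<alpha> j)) ` {..<2 * n})"
      unfolding Omega_def Un_iff mem_Collect_eq singleton_iff ext_point.inject ext_point.distinct
      by blast
    with M show "u > Max ((\<lambda>j. cos (\<theta> - \<alpha> j)) ` {..<2 * n})"
      by metis
  next
    assume "u > Max ((\<lambda>j. cos (\<theta> - \<alpha> j)) ` {..<2 * n})"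
    then show "Pt u (angle_of \<theta>) \<in> Omega n \<alpha>"
      unfolding Omega_def by blast
  qed
  then show ?thesis
    by (auto simp add: dom_fin_def chart_fin_def)
qed

lemma topspace_Omega_top:
  assumes "n > 0"
  shows "topspace (Omega_top n \<alpha>) = Omega n \<alpha>"
proof -
  have ne: "{..<2 * n} \<noteq> {}"
    using assms by (auto simp: lessThan_empty_iff)
  have eq: "dom_fin n \<alpha> = (\<Inter>j\<in>{..<2 * n}. {p. cos (snd p - \<alpha> j) < fst p})"
    using ne by (auto simp: dom_fin_eq)
  have op: "open (dom_fin n \<alpha>)"
    unfolding eq by (intro open_INT ballI open_Collect_less continuous_intros) auto
  have "chart_inf p \<in> Omega n \<alpha>" if "p \<in> dom_inf" for p
  proof (cases "p = 0")
    case True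
    then show ?thesis
      by (simp add: chart_inf_def iota_def Omega_def zero_prod_def complex_eq_iff)
  next
    case False
    obtain x y where p: "p = (x, y)"
      by force
    define r where "r = cmod (Complex x y)"
    have "r = norm p"
      by (simp add: p r_def norm_Pair cmod_def)
    then have r: "0 < r" "r < 1"
      using False that by (auto simp: dom_inf_def)
    have "0 < (r - 1)\<^sup>2"
      using r by simp
    then have "1 < (r + inverse r) / 2"
      using r by (simp add: field_simps power2_eq_square)
    then have "Max ((\<lambda>j. cos (Arg (Complex x y) - \<alpha> j)) ` {..<2 * n}) < (r + inverse r) / 2"
      using ne by (subst Max_less_iff) (auto simp only: image_iff finite_imageI finite_lessThan
          image_is_empty intro: le_less_trans[OF cos_le_one])
    moreover have "chart_inf p = Pt ((r + inverse r) / 2) (angle_of (Arg (Complex x y)))"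
      using r by (auto simp: p chart_inf_def iota_def r_def)
    ultimately show ?thesis
      unfolding Omega_def by blast
  qed
  then have "{p \<in> dom_inf. chart_inf p \<in> Omega n \<alpha>} = dom_inf"
    by auto
  moreover have "{p \<in> dom_fin n \<alpha>. chart_fin p \<in> Omega n \<alpha>} = dom_fin n \<alpha>"
    by (auto simp: dom_fin_def)
  ultimately have "Omega_openin n \<alpha> (Omega n \<alpha>)"
    using op by (simp add: Omega_openin_def dom_inf_def)
  then show ?thesis
    unfolding topspace_def openin_Omega_top by (auto simp: Omega_openin_def)
qed


section \<open>Real analytic maps and immersions\<close>

definition real_analytic_on2 ::
  "(real \<times> real \<Rightarrow> 'v::real_normed_vector) \<Rightarrow> (real \<times> real) set \<Rightarrow> bool"
  where "real_analytic_on2 h U \<longleftrightarrow>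
    (\<forall>(a, b)\<in>U. \<exists>c :: nat \<times> nat \<Rightarrow> 'v. \<exists>\<epsilon>>0. \<forall>x y. \<bar>x - a\<bar> < \<epsilon> \<and> \<bar>y - b\<bar> < \<epsilon> \<longrightarrow>
      ((\<lambda>(i, j). ((x - a) ^ i * (y - b) ^ j) *\<^sub>R c (i, j)) has_sum h (x, y)) UNIV)"

definition analytic_on_Omega :: "nat \<Rightarrow> (nat \<Rightarrow> real) \<Rightarrow> (ext_point \<Rightarrow> real^3) \<Rightarrow> bool"
  where "analytic_on_Omega n \<alpha> F \<longleftrightarrow>
    real_analytic_on2 (F \<circ> chart_fin) (dom_fin n \<alpha>) \<and> real_analytic_on2 (F \<circ> chart_inf) dom_inf"

definition injective_differential_on ::
  "('a::real_normed_vector \<Rightarrow> 'b::real_normed_vector) \<Rightarrow> 'a set \<Rightarrow> bool"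
  where "injective_differential_on h U \<longleftrightarrow> (\<forall>p\<in>U. \<exists>D. (h has_derivative D) (at p) \<and> inj D)"

definition analytic_immersion_on_Omega :: "nat \<Rightarrow> (nat \<Rightarrow> real) \<Rightarrow> (ext_point \<Rightarrow> real^3) \<Rightarrow> bool"
  where "analytic_immersion_on_Omega n \<alpha> F \<longleftrightarrow>
    analytic_on_Omega n \<alpha> F \<and>
    injective_differential_on (F \<circ> chart_fin) (dom_fin n \<alpha>) \<and>
    injective_differential_on (F \<circ> chart_inf) dom_inf"

definition analytic_extension ::
  "nat \<Rightarrow> (nat \<Rightarrow> real) \<Rightarrow> (riemann_sphere \<Rightarrow> real^3) \<Rightarrow> (ext_point \<Rightarrow> real^3) \<Rightarrow> bool"
  where "analytic_extension n \<alpha> f F \<longleftrightarrow>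
    analytic_on_Omega n \<alpha> F \<and> (\<forall>z\<in>cball 0 1 - kob_ends n \<alpha>. F (iota z) = f (Fin z))"

end

theory Submission imports Defs
begin

text \<open>
  All residues of the Weierstrass data at the ends \<open>cis (\<alpha> j)\<close> are real multiples of the null vectors
  \<open>v\<^sub>j = (-1, cos ((n - 1) \<alpha> j), sin ((n - 1) \<alpha> j))\<close>, and they add up to zero. Since
  \<open>\<bar>z - cis \<alpha>\<bar>\<^sup>2 = 2 r (u - cos (\<theta> - \<alpha>))\<close>, the extension is
  \<open>\<Sum>\<^sub>j B\<^sub>j ln (u - cos (\<theta> - \<alpha> j)) v\<^sub>j + C\<close>; it agrees with \<open>f\<close> for \<open>u > 1\<close>, and analytic
  continuation along the lines of constant \<open>\<theta>\<close> gives it everywhere.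

  A point \<open>(cos \<beta>, \<theta>)\<close> of the closure of the domain has no end in the open arc of radius \<open>\<beta>\<close> about
  \<open>\<theta>\<close>, so the hypothesis on the gaps gives \<open>(n - 1) \<beta> < pi\<close>. Hence \<open>g\<close> takes distinct values at the
  ends of that arc. In the interior this makes the differential injective. On the boundary it
  makes the directions of the at most two divergent logarithms linearly independent, so that the
  map tends to infinity.
\<close>

section \<open>Partial fractions and power series\<close>

text \<open>Lagrange interpolation: \<open>L\<close> has degree below \<open>card I\<close> and
  takes the value \<open>p i ^ m\<close> at every node, so it is the monomial of degree
  \<open>m\<close>. Dividing by the full product gives the partial fractions.\<close>

lemma partial_fractions_monomial:
  fixes p :: "'i \<Rightarrow> 'a::field"
  assumes "finite I" "inj_on p I" "m < card I" "X \<notin> p ` I"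
  shows "(\<Sum>j\<in>I. p j ^ m / (\<Prod>k\<in>I - {j}. p j - p k) / (X - p j)) = X ^ m / (\<Prod>j\<in>I. X - p j)"
proof -
  define c where "c j = p j ^ m / (\<Prod>k\<in>I - {j}. p j - p k)" for j
  define L where "L = (\<Sum>j\<in>I. smult (c j) (\<Prod>k\<in>I - {j}. [:- p k, 1:]))"
  have poly_L: "poly L x = (\<Sum>j\<in>I. c j * (\<Prod>k\<in>I - {j}. x - p k))" for x
    by (simp add: L_def poly_sum poly_prod)
  have "degree (smult (c j) (\<Prod>k\<in>I - {j}. [:- p k, 1:])) < card I" if "j \<in> I" for j
  proof -
    have "degree (\<Prod>k\<in>I - {j}. [:- p k, 1:]) \<le> (\<Sum>k\<in>I - {j}. degree [:- p k, 1:])"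
      using degree_prod_sum_le[of "I - {j}" "\<lambda>k. [:- p k, 1:]"] assms(1) by (simp add: o_def)
    also have "\<dots> < card I"
      using card_Diff1_less[OF assms(1) that] by simp
    finally show ?thesis
      by (meson degree_smult_le le_less_trans)
  qed
  then have deg: "degree L < card I"
    unfolding L_def using assms(3) by (intro degree_sum_less) auto
  have "poly L (p i) = p i ^ m" if i: "i \<in> I" for i
  proof -
    have "c j * (\<Prod>k\<in>I - {j}. p i - p k) = (if j = i then p i ^ m else 0)" if "j \<in> I" for j
    proof (cases "j = i")
      case True
      have "(\<Prod>k\<in>I - {i}. p i - p k) \<noteq> 0"
        using assms(1,2) i by (auto simp: inj_on_def)
      then show ?thesis
        using True by (simp add: c_def)
    next
      case False
      then have "(\<Prod>k\<in>I - {j}. p i - p k) = 0"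
        using assms(1) i by (auto simp: prod_zero_iff)
      then show ?thesis
        using False by simp
    qed
    then show ?thesis
      using i assms(1) by (simp add: poly_L)
  qed
  then have "L = monom 1 m"
    using deg assms by (intro poly_eqI_degree[of "p ` I"])
      (auto simp: poly_monom card_image degree_monom_eq)
  then have X: "(\<Sum>j\<in>I. c j * (\<Prod>k\<in>I - {j}. X - p k)) = X ^ m"
    using poly_L[of X] by (simp add: poly_monom)
  have nz: "(\<Prod>j\<in>I. X - p j) \<noteq> 0"
    using assms(1,4) by auto
  have "c j / (X - p j) = c j * (\<Prod>k\<in>I - {j}. X - p k) / (\<Prod>j\<in>I. X - p j)" if "j \<in> I" for j
  proof -
    have "(\<Prod>j\<in>I. X - p j) = (X - p j) * (\<Prod>k\<in>I - {j}. X - p k)"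
      using assms(1) that by (rule prod.remove)
    then show ?thesis
      using nz by simp
  qed
  then have "(\<Sum>j\<in>I. c j / (X - p j)) = (\<Sum>j\<in>I. c j * (\<Prod>k\<in>I - {j}. X - p k)) / (\<Prod>j\<in>I. X - p j)"
    by (simp add: sum_divide_distrib)
  then show ?thesis
    unfolding X unfolding c_def .
qed

text \<open>Identity theorem on a half-line, through the supremum \<open>s\<close> of the points
  where \<open>h\<close> is nonzero. A nonzero coefficient at \<open>s\<close> would make
  \<open>s\<close> an isolated zero, against the vanishing to its right; if all coefficients are
  zero, \<open>h\<close> vanishes also on an interval to the left of \<open>s\<close>.\<close>

lemma vanishes_right_of_power_series:
  fixes h :: "real \<Rightarrow> real"
  assumes series: "\<And>a. a > l \<Longrightarrow>
      \<exists>c. \<exists>\<epsilon>>0. \<forall>x. \<bar>x - a\<bar> < \<epsilon> \<longrightarrow> (\<lambda>i. c i * (x - a) ^ i) sums h x"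
    and zero: "\<And>x. x > b \<Longrightarrow> h x = 0" and "x > l"
  shows "h x = 0"
proof (rule ccontr)
  assume "h x \<noteq> 0"
  define S where "S = {x. x > l \<and> h x \<noteq> 0}"
  have ne: "S \<noteq> {}"
    using \<open>h x \<noteq> 0\<close> \<open>x > l\<close> by (auto simp: S_def)
  have bdd: "bdd_above S"
  proof (rule bdd_aboveI)
    show "y \<le> b" if "y \<in> S" for y
      using that zero[of y] unfolding S_def by force
  qed
  define s where "s = Sup S"
  have "x \<le> s"
    unfolding s_def using \<open>h x \<noteq> 0\<close> \<open>x > l\<close> bdd by (intro cSup_upper) (auto simp: S_def)
  then have "s > l"
    using \<open>x > l\<close> by simp
  have right: "h y = 0" if "y > s" for y
    using cSup_upper[OF _ bdd, of y] that \<open>s > l\<close> by (force simp: S_def s_def)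
  obtain c \<epsilon> where "\<epsilon> > 0" and sums: "\<And>x. \<bar>x - s\<bar> < \<epsilon> \<Longrightarrow> (\<lambda>i. c i * (x - s) ^ i) sums h x"
    using series[OF \<open>s > l\<close>] by blast
  \<comment> \<open>The constant term comes first: isolation of zeros is available only once
    \<open>h s = 0\<close> is known.\<close>
  have "((\<lambda>y. h (s + y)) \<longlongrightarrow> c 0) (at 0)"
    using \<open>\<epsilon> > 0\<close> sums[of "s + _"] by (intro powser_limit_0[of \<epsilon>]) auto
  then have "((\<lambda>y. h (s + y)) \<longlongrightarrow> c 0) (at_right 0)"
    by (rule filterlim_mono) (auto simp: at_le)
  moreover have "((\<lambda>y. h (s + y)) \<longlongrightarrow> 0) (at_right 0)"
    using right by (intro tendsto_eventually eventually_mono[OF eventually_at_right_less[of 0]]) simp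
  ultimately have c0: "c 0 = 0"
    by (rule tendsto_unique[rotated]) simp
  then have hs: "h s = 0"
    using sums[of s] \<open>\<epsilon> > 0\<close> powser_sums_zero_iff[of c "h s"] by simp
  have "c m = 0" for m
  proof (rule ccontr)
    assume "c m \<noteq> 0"
    then have "m > 0"
      using c0 by (cases m) auto
    obtain d where "d > 0" and d: "\<And>z. z \<in> cball s d - {s} \<Longrightarrow> h z \<noteq> 0"
      using powser_0_nonzero[where f = h and \<xi> = s and a = c and r = \<epsilon> and m = m]
        sums hs \<open>\<epsilon> > 0\<close> \<open>c m \<noteq> 0\<close> \<open>m > 0\<close> by auto
    then have "h (s + d) \<noteq> 0"
      by (intro d) (auto simp: dist_real_def)
    then show False
      using right[of "s + d"] \<open>d > 0\<close> by simp
  qed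
  then have "h y = 0" if "\<bar>y - s\<bar> < \<epsilon>" for y
    using sums[OF that] sums_unique2[OF sums_zero] by simp
  then have "y \<le> s - \<epsilon>" if "y \<in> S" for y
    using that right[of y] unfolding S_def by force
  then have "s \<le> s - \<epsilon>"
    unfolding s_def using ne by (intro cSup_least) auto
  then show False
    using \<open>\<epsilon> > 0\<close> by simp
qed

text \<open>On the line \<open>y = b\<close> every term with \<open>j > 0\<close> vanishes, while
  \<open>0 ^ 0 = 1\<close> keeps the terms with \<open>j = 0\<close>.\<close>

lemma real_analytic_on2_fst_series:
  assumes "real_analytic_on2 h U" "(a, b) \<in> U"
  shows "\<exists>c. \<exists>\<epsilon>>0. \<forall>x. \<bar>x - a\<bar> < \<epsilon> \<longrightarrow> (\<lambda>i. (x - a) ^ i *\<^sub>R c i) sums h (x, b)"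
proof -
  obtain c :: "nat \<times> nat \<Rightarrow> 'a" and \<epsilon> where "\<epsilon> > 0" and
    c: "\<And>x y. \<bar>x - a\<bar> < \<epsilon> \<and> \<bar>y - b\<bar> < \<epsilon> \<Longrightarrow>
      ((\<lambda>(i, j). ((x - a) ^ i * (y - b) ^ j) *\<^sub>R c (i, j)) has_sum h (x, y)) UNIV"
    using assms unfolding real_analytic_on2_def by blast
  have "(\<lambda>i. (x - a) ^ i *\<^sub>R c (i, 0)) sums h (x, b)" if "\<bar>x - a\<bar> < \<epsilon>" for x
  proof -
    have "((\<lambda>(i, j). ((x - a) ^ i * (b - b) ^ j) *\<^sub>R c (i, j)) has_sum h (x, b)) UNIV"
      using c[of x b] that \<open>\<epsilon> > 0\<close> by simp
    also have "?this \<longleftrightarrow>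
        ((\<lambda>(i, j). ((x - a) ^ i * (b - b) ^ j) *\<^sub>R c (i, j)) has_sum h (x, b)) (range (\<lambda>i. (i, 0)))"
      by (rule has_sum_cong_neutral) (auto simp: image_iff)
    also have "\<dots> \<longleftrightarrow> ((\<lambda>i. (x - a) ^ i *\<^sub>R c (i, 0)) has_sum h (x, b)) UNIV"
      by (subst has_sum_reindex) (auto simp: inj_on_def o_def)
    finally show ?thesis
      by (rule has_sum_imp_sums)
  qed
  then show ?thesis
    using \<open>\<epsilon> > 0\<close> by (intro exI[of _ "\<lambda>i. c (i, 0)"] exI[of _ \<epsilon>]) simp
qed

text \<open>On the complex disk of radius \<open>a - l\<close> about \<open>a\<close> all the
  arguments \<open>z - d j\<close> have positive real part, so the sum of principal logarithms is
  holomorphic there. The real parts of its Taylor coefficients serve on the real axis.\<close>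

lemma sum_ln_power_series:
  fixes d w :: "'i \<Rightarrow> real"
  assumes "\<And>j. j \<in> I \<Longrightarrow> d j \<le> l" "a > l"
  shows "\<exists>c. \<exists>\<epsilon>>0. \<forall>x. \<bar>x - a\<bar> < \<epsilon> \<longrightarrow>
    (\<lambda>i. c i * (x - a) ^ i) sums ((\<Sum>j\<in>I. w j * ln (x - d j)) + C)"
proof -
  define G where "G z = (\<Sum>j\<in>I. of_real (w j) * Ln (z - of_real (d j))) + of_real C" for z
  have pos: "Re z > l" if "z \<in> ball (of_real a) (a - l)" for z
    using that abs_Re_le_cmod[of "of_real a - z"] by (auto simp: dist_norm abs_if split: if_splits)
  have "G holomorphic_on ball (of_real a) (a - l)"
    unfolding G_def using pos assms(1)
    by (intro holomorphic_intros) (fastforce simp: complex_nonpos_Reals_iff)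
  then have sums: "(\<lambda>i. (deriv ^^ i) G (of_real a) / fact i * (z - of_real a) ^ i) sums G z"
    if "z \<in> ball (of_real a) (a - l)" for z
    using that by (rule holomorphic_power_series)
  have "(\<lambda>i. Re ((deriv ^^ i) G (of_real a) / fact i) * (x - a) ^ i) sums
      ((\<Sum>j\<in>I. w j * ln (x - d j)) + C)" if "\<bar>x - a\<bar> < a - l" for x
  proof -
    have x: "complex_of_real x \<in> ball (of_real a) (a - l)"
      using that by (simp add: dist_norm norm_minus_commute flip: of_real_diff)
    have "Ln (of_real x - of_real (d j)) = of_real (ln (x - d j))" if "j \<in> I" for j
      using pos[OF x] assms(1)[OF that] by (simp add: Ln_of_real flip: of_real_diff)
    then have "Re (G (of_real x)) = (\<Sum>j\<in>I. w j * ln (x - d j)) + C"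
      by (simp add: G_def)
    moreover have "Re ((deriv ^^ i) G (of_real a) / fact i * (of_real x - of_real a) ^ i) =
        Re ((deriv ^^ i) G (of_real a) / fact i) * (x - a) ^ i" for i
      by (simp only: of_real_diff[symmetric] of_real_power[symmetric] times_complex.simps
          Re_complex_of_real Im_complex_of_real mult_zero_right diff_zero)
    ultimately show ?thesis
      using sums_Re[OF sums[OF x]] by simp
  qed
  then show ?thesis
    using assms(2) by (intro exI[of _ "\<lambda>i. Re ((deriv ^^ i) G (of_real a) / fact i)"] exI[of _ "a - l"]) auto
qed

text \<open>\<open>Ln (z - p)\<close> itself may meet the branch cut. For
  \<open>cmod z < cmod p\<close> the number \<open>1 - z / p\<close> stays in the right half-plane,
  and the real part of its logarithm differs from the function only by the constant
  \<open>ln (cmod p)\<close>.\<close>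

lemma ln_cmod_has_derivative:
  assumes "cmod z < cmod p"
  shows "((\<lambda>z. ln (cmod (z - p))) has_derivative (\<lambda>dz. Re (dz / (z - p)))) (at z)"
proof -
  have p: "p \<noteq> 0"
    using assms by auto
  have "cmod (z / p) < 1"
    using assms p by (simp add: norm_divide)
  then have "Re (1 - z / p) > 0"
    using complex_Re_le_cmod[of "z / p"] by simp
  then have "1 - z / p \<notin> \<real>\<^sub>\<le>\<^sub>0"
    by (auto simp: complex_nonpos_Reals_iff)
  then have "((\<lambda>z. Ln (1 - z / p)) has_field_derivative - (1 / p) / (1 - z / p)) (at z)"
    using p by (auto intro!: derivative_eq_intros simp: inverse_eq_divide)
  moreover have "- (1 / p) / (1 - z / p) = 1 / (z - p)"
    using p assms by (auto simp: divide_simps)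
  ultimately have "((\<lambda>z. Ln (1 - z / p)) has_derivative (\<lambda>dz. 1 / (z - p) * dz)) (at z)"
    by (simp only: has_field_derivative_def)
  then have D: "((\<lambda>z. Re (Ln (1 - z / p)) + ln (cmod p)) has_derivative (\<lambda>dz. Re (dz / (z - p)))) (at z)"
    by (intro has_derivative_eq_rhs[OF has_derivative_add_const[OF has_derivative_Re]]) auto
  show ?thesis
  proof (rule has_derivative_transform_within_open[OF D])
    show "open {z. cmod z < cmod p}"
      by (intro open_Collect_less continuous_intros)
    fix w assume "w \<in> {z. cmod z < cmod p}"
    then have "1 - w / p \<noteq> 0" "w \<noteq> p"
      using p by auto
    moreover have "1 - w / p = - (w - p) / p"
      using p by (simp add: field_simps)
    ultimately show "Re (Ln (1 - w / p)) + ln (cmod p) = ln (cmod (w - p))"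
      using p by (simp add: norm_divide ln_div norm_minus_commute)
  qed (use assms in auto)
qed

section \<open>Unit complex numbers and angles modulo \<open>2 * pi\<close>\<close>

lemma cis_sum: "cis (\<Sum>k\<in>A. x k) = (\<Prod>k\<in>A. cis (x k))"
  by (induction A rule: infinite_finite_induct) (auto simp: cis_mult[symmetric])

lemma cis_eq_cisE:
  assumes "cis a = cis b"
  obtains k :: int where "a - b = 2 * pi * of_int k"
proof -
  have "cis (a - b) = 1"
    using assms by (simp flip: cis_divide)
  then have "cos (a - b) = 1"
    by (simp add: complex_eq_iff)
  then show ?thesis
    using that by (auto simp: cos_one_2pi_int mult_ac)
qed

text \<open>Taking out the phase of the midpoint leaves an imaginary number; this is what brings out
  the real weights at the ends.\<close>

lemma cis_diff_eq: "cis a - cis b = cis ((a + b) / 2) * (2 * \<i> * of_real (sin ((a - b) / 2)))"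
proof -
  have "cis a = cis ((a + b) / 2) * cis ((a - b) / 2)" "cis b = cis ((a + b) / 2) * cis (- ((a - b) / 2))"
    by (simp_all only: cis_mult) (simp_all add: field_simps)
  moreover have "cis t - cis (- t) = 2 * \<i> * of_real (sin t)" for t
    by (simp add: complex_eq_iff)
  ultimately show ?thesis
    by (metis right_diff_distrib)
qed

lemma angle_mod_2pi:
  obtains k :: int where "0 \<le> t - 2 * pi * of_int k" "t - 2 * pi * of_int k < 2 * pi"
proof -
  define k where "k = \<lfloor>t / (2 * pi)\<rfloor>"
  have "of_int k \<le> t / (2 * pi)" "t / (2 * pi) < of_int k + 1"
    by (simp_all add: k_def)
  then show ?thesis
    by (intro that[of k]) (simp_all add: field_simps)
qed

lemma cos_le_cos_imp_bounds:
  assumes "cos x \<le> cos \<beta>" "0 \<le> x" "x \<le> 2 * pi" "0 \<le> \<beta>" "\<beta> \<le> pi"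
  shows "\<beta> \<le> x" "x \<le> 2 * pi - \<beta>"
proof -
  show "\<beta> \<le> x"
    using assms cos_monotone_0_pi[of x \<beta>] by force
  have "cos (2 * pi - x) = cos x"
    by (simp add: cos_diff)
  then show "x \<le> 2 * pi - \<beta>"
    using assms cos_monotone_0_pi[of "2 * pi - x" \<beta>] by force
qed

text \<open>Numerator and denominator are both quadratic in \<open>p\<close>, hence the constant
  term \<open>l\<close> beside the two simple fractions.\<close>

lemma reciprocal_quadratic_expand:
  fixes p x y k l :: "'a::field"
  assumes "x \<noteq> y" "p \<noteq> x" "p \<noteq> y"
  shows "(k * p - l * (x * y - p\<^sup>2)) / ((p - x) * (p - y)) =
    l + (k * x - l * (x * y - x\<^sup>2)) / (x - y) / (p - x) - (k * y - l * (x * y - y\<^sup>2)) / (x - y) / (p - y)"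
proof -
  have "x - y \<noteq> 0" "p - x \<noteq> 0" "p - y \<noteq> 0"
    using assms by auto
  then show ?thesis
    by (simp add: divide_simps) (simp add: algebra_simps power2_eq_square)
qed

section \<open>Residues and the gap condition\<close>

text \<open>With \<open>\<alpha> (2 * n) = 2 * pi\<close> the arc from the last end back to the end
  \<open>0\<close> is treated like the other arcs.\<close>

locale kobayashi_data =
  fixes n :: nat and \<alpha> :: "nat \<Rightarrow> real"
  assumes n_ge: "2 \<le> n" and \<alpha>_0: "\<alpha> 0 = 0" and \<alpha>_end: "\<alpha> (2 * n) = 2 * pi"
    and \<alpha>_less: "\<And>j. j < 2 * n \<Longrightarrow> \<alpha> j < \<alpha> (Suc j)"
    and gap: "\<And>j. j < 2 * n \<Longrightarrow> \<alpha> (Suc j) - \<alpha> j < 2 * pi / (real n - 1)"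
begin

abbreviation pole :: "nat \<Rightarrow> complex"
  where "pole j \<equiv> cis (\<alpha> j)"

lemma \<alpha>_strict_mono: "i < j \<Longrightarrow> j \<le> 2 * n \<Longrightarrow> \<alpha> i < \<alpha> j"
proof (induction j)
  case (Suc j)
  then show ?case
    using \<alpha>_less[of j] by (cases "i = j") auto
qed simp

lemma \<alpha>_bounds: "j < 2 * n \<Longrightarrow> 0 \<le> \<alpha> j \<and> \<alpha> j < 2 * pi"
  using \<alpha>_strict_mono[of 0 j] \<alpha>_strict_mono[of j "2 * n"] \<alpha>_0 \<alpha>_end by (cases "j = 0") auto

lemma inj_on_pole: "inj_on pole {..<2 * n}"
proof (rule inj_onI)
  fix i j assume ij: "i \<in> {..<2 * n}" "j \<in> {..<2 * n}" "pole i = pole j"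
  obtain k :: int where k: "\<alpha> i - \<alpha> j = 2 * pi * of_int k"
    using ij(3) by (rule cis_eq_cisE)
  have "\<bar>\<alpha> i - \<alpha> j\<bar> < 2 * pi"
    using \<alpha>_bounds[of i] \<alpha>_bounds[of j] ij by (auto simp: abs_if)
  then have "\<bar>of_int k :: real\<bar> < 1"
    by (simp add: k abs_mult)
  then have "k = 0"
    by linarith
  then have "\<alpha> i = \<alpha> j"
    using k by simp
  then show "i = j"
    using \<alpha>_strict_mono[of i j] \<alpha>_strict_mono[of j i] ij by (cases i j rule: linorder_cases) auto
qed

definition res :: "nat \<Rightarrow> complex"
  where "res j = \<i> * kob_Lambda n \<alpha> / (\<Prod>k\<in>{..<2 * n} - {j}. pole j - pole k)"

text \<open>The residue of \<open>g \<omega>\<close> at \<open>pole j\<close> in a visibly real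
  form; the sines are half chords between the ends.\<close>

definition weight :: "nat \<Rightarrow> real"
  where "weight j =
    1 / ((- 1) ^ (n - 1) * 2 ^ (2 * n - 1) * (\<Prod>k\<in>{..<2 * n} - {j}. sin ((\<alpha> j - \<alpha> k) / 2)))"

text \<open>\<open>2 * weight j\<close> times this vector is the residue of the Weierstrass form at
  \<open>pole j\<close>.\<close>

definition dir :: "nat \<Rightarrow> real^3"
  where "dir j = vector [- 1, cos (real (n - 1) * \<alpha> j), sin (real (n - 1) * \<alpha> j)]"

text \<open>The phases of the chords multiply to
  \<open>pole j ^ (n - 1) * kob_Lambda n \<alpha>\<close>, so the constant \<open>kob_Lambda\<close>
  in the numerator cancels. The \<open>2 * n - 1\<close> factors \<open>\<i>\<close> of the chords
  cancel the remaining \<open>\<i>\<close> up to sign.\<close>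

lemma res_eq_weight:
  assumes "j < 2 * n"
  shows "res j * pole j ^ (n - 1) = of_real (weight j)"
proof -
  let ?K = "{..<2 * n} - {j}"
  let ?S = "\<Sum>k<2 * n. \<alpha> k"
  have card: "card ?K = 2 * n - 1"
    using assms by simp
  have "(\<Sum>k\<in>?K. (\<alpha> j + \<alpha> k) / 2) = (real (2 * n - 1) * \<alpha> j + (\<Sum>k\<in>?K. \<alpha> k)) / 2"
    by (simp only: sum_divide_distrib[symmetric] sum.distrib sum_constant card)
  also have "\<dots> = real (n - 1) * \<alpha> j + ?S / 2"
    using assms n_ge by (simp add: sum_diff1 of_nat_diff field_simps)
  finally have *: "(\<Sum>k\<in>?K. (\<alpha> j + \<alpha> k) / 2) = real (n - 1) * \<alpha> j + ?S / 2" .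
  have "kob_Lambda n \<alpha> = cis (?S / 2)"
    by (simp only: kob_Lambda_def cis_conv_exp)
  then have "(\<Prod>k\<in>?K. cis ((\<alpha> j + \<alpha> k) / 2)) = pole j ^ (n - 1) * kob_Lambda n \<alpha>"
    by (simp only: cis_sum[symmetric] * Complex.DeMoivre cis_mult)
  moreover have "(2 * \<i>) ^ (2 * n - 1) = of_real ((- 1) ^ (n - 1) * 2 ^ (2 * n - 1)) * \<i>"
  proof -
    have "\<i> ^ (2 * n - 1) = \<i> ^ (2 * (n - 1)) * \<i>"
      using n_ge by (simp flip: power_Suc2 add: Suc_diff_Suc numeral_2_eq_2)
    then show ?thesis
      by (simp add: power_mult_distrib power_mult)
  qed
  ultimately have "(\<Prod>k\<in>?K. pole j - pole k) = pole j ^ (n - 1) * kob_Lambda n \<alpha> *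
      (of_real ((- 1) ^ (n - 1) * 2 ^ (2 * n - 1)) * \<i> * of_real (\<Prod>k\<in>?K. sin ((\<alpha> j - \<alpha> k) / 2)))"
    by (simp add: cis_diff_eq prod.distrib card)
  moreover have "kob_Lambda n \<alpha> \<noteq> 0"
    by (simp add: kob_Lambda_def)
  ultimately show ?thesis
    by (simp add: res_def weight_def)
qed

lemma weight_nonzero: "j < 2 * n \<Longrightarrow> weight j \<noteq> 0"
proof -
  assume j: "j < 2 * n"
  have "res j \<noteq> 0"
    using inj_on_pole j by (auto simp: res_def kob_Lambda_def inj_on_def)
  then show ?thesis
    using res_eq_weight[OF j] by (metis cis_neq_zero mult_eq_0_iff of_real_0 power_not_zero)
qed

lemma sum_res_over:
  assumes "m < 2 * n" "X \<notin> kob_ends n \<alpha>"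
  shows "(\<Sum>j<2 * n. res j * pole j ^ m / (X - pole j)) = X ^ m * kob_omega n \<alpha> X"
proof -
  have "(\<Sum>j<2 * n. res j * pole j ^ m / (X - pole j)) = \<i> * kob_Lambda n \<alpha> *
      (\<Sum>j<2 * n. pole j ^ m / (\<Prod>k\<in>{..<2 * n} - {j}. pole j - pole k) / (X - pole j))"
    by (simp add: res_def sum_distrib_left mult_ac)
  also have "\<dots> = X ^ m * kob_omega n \<alpha> X"
    using assms inj_on_pole by (subst partial_fractions_monomial) (auto simp: kob_ends_def kob_omega_def)
  finally show ?thesis .
qed

text \<open>Evaluate the partial fractions for the exponent \<open>Suc m\<close> at
  \<open>X = 0\<close>, which is not an end. In effect, \<open>z ^ m\<close> times the form has no
  residue at infinity.\<close>

lemma sum_res_moment: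
  assumes "Suc m < 2 * n"
  shows "(\<Sum>j<2 * n. res j * pole j ^ m) = 0"
proof -
  have "0 \<notin> kob_ends n \<alpha>"
    by (auto simp: kob_ends_def)
  then show ?thesis
    using sum_res_over[OF assms, of 0] by (simp add: sum_negf)
qed

lemma weight_dir_components:
  assumes "j < 2 * n"
  shows "of_real (weight j * dir j $ 1) = - (res j * pole j ^ (n - 1))"
    and "of_real (weight j * dir j $ 2) = (res j + res j * pole j ^ (2 * n - 2)) / 2"
    and "of_real (weight j * dir j $ 3) = \<i> * (res j - res j * pole j ^ (2 * n - 2)) / 2"
proof -
  define e where "e = pole j ^ (n - 1)"
  have e: "e = cis (real (n - 1) * \<alpha> j)"
    by (simp add: e_def Complex.DeMoivre)
  have e2: "pole j ^ (2 * n - 2) = e\<^sup>2"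
    by (simp add: e_def flip: power_mult) (simp add: diff_mult_distrib2 mult.commute)
  have [simp]: "e \<noteq> 0"
    by (simp add: e)
  have "1 / e = cis (- (real (n - 1) * \<alpha> j))"
    by (simp add: e divide_inverse)
  then have "2 * of_real (cos (real (n - 1) * \<alpha> j)) = e + 1 / e"
    "2 * \<i> * of_real (sin (real (n - 1) * \<alpha> j)) = e - 1 / e"
    by (simp_all add: e complex_eq_iff)
  then have ccs: "of_real (cos (real (n - 1) * \<alpha> j)) = (e + 1 / e) / 2"
    "of_real (sin (real (n - 1) * \<alpha> j)) = (e - 1 / e) / (2 * \<i>)"
    by (simp_all add: eq_divide_eq mult.commute)
  have w: "of_real (weight j) = res j * e"
    using res_eq_weight[OF assms] by (simp add: e_def)
  show "of_real (weight j * dir j $ 1) = - (res j * pole j ^ (n - 1))"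
    using w by (simp add: dir_def e_def)
  show "of_real (weight j * dir j $ 2) = (res j + res j * pole j ^ (2 * n - 2)) / 2"
    unfolding of_real_mult w dir_def vector_3 ccs e2 by (simp add: field_simps power2_eq_square)
  show "of_real (weight j * dir j $ 3) = \<i> * (res j - res j * pole j ^ (2 * n - 2)) / 2"
    unfolding of_real_mult w dir_def vector_3 ccs e2 by (simp add: field_simps power2_eq_square)
qed

lemma weierstrass_form_eq:
  assumes "z \<notin> kob_ends n \<alpha>"
  shows "weierstrass_form (kob_g n) (kob_omega n \<alpha>) z $ k =
    (\<Sum>j<2 * n. of_real (2 * (weight j * dir j $ k)) / (z - pole j))"
proof -
  let ?h = "kob_omega n \<alpha> z"
  let ?s = "\<lambda>m. \<Sum>j<2 * n. res j * pole j ^ m / (z - pole j)"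
  \<comment> \<open>The exponents of \<open>1\<close>, \<open>g\<close> and \<open>g\<close> squared
    are all below the number \<open>2 * n\<close> of ends.\<close>
  have s: "?s 0 = ?h" "?s (n - 1) = z ^ (n - 1) * ?h" "?s (2 * n - 2) = z ^ (2 * n - 2) * ?h"
    using n_ge assms by (subst sum_res_over; simp)+
  have g: "(kob_g n z)\<^sup>2 = z ^ (2 * n - 2)"
    by (simp add: kob_g_def flip: power_mult) (simp add: diff_mult_distrib2 mult.commute)
  have t: "2 * of_real (weight j * dir j $ k) / (z - pole j) = of_real (2 * (weight j * dir j $ k)) / (z - pole j)" for j k
    by simp
  have "(\<Sum>j<2 * n. of_real (2 * (weight j * dir j $ 1)) / (z - pole j)) = - 2 * ?s (n - 1)"
    by (simp add: weight_dir_components sum_distrib_left del: of_real_mult flip: t)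
  moreover have "(\<Sum>j<2 * n. of_real (2 * (weight j * dir j $ 2)) / (z - pole j)) = ?s 0 + ?s (2 * n - 2)"
    by (simp add: weight_dir_components add_divide_distrib sum.distrib del: of_real_mult flip: t)
  moreover have "(\<Sum>j<2 * n. of_real (2 * (weight j * dir j $ 3)) / (z - pole j)) = \<i> * (?s 0 - ?s (2 * n - 2))"
    by (simp add: weight_dir_components diff_divide_distrib right_diff_distrib sum_subtractf sum_distrib_left
        del: of_real_mult flip: t)
  moreover have "weierstrass_form (kob_g n) (kob_omega n \<alpha>) z $ 1 = - 2 * ?s (n - 1)"
      "weierstrass_form (kob_g n) (kob_omega n \<alpha>) z $ 2 = ?s 0 + ?s (2 * n - 2)"
      "weierstrass_form (kob_g n) (kob_omega n \<alpha>) z $ 3 = \<i> * (?s 0 - ?s (2 * n - 2))"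
    unfolding s by (simp_all add: weierstrass_form_def g) (simp_all add: kob_g_def algebra_simps)
  ultimately have "\<forall>k. weierstrass_form (kob_g n) (kob_omega n \<alpha>) z $ k =
      (\<Sum>j<2 * n. of_real (2 * (weight j * dir j $ k)) / (z - pole j))"
    by (simp only: forall_3 simp_thms)
  then show ?thesis ..
qed

lemma sum_weight_dir: "(\<Sum>j<2 * n. weight j *\<^sub>R dir j) = 0"
proof -
  have s: "(\<Sum>j<2 * n. res j) = 0" "(\<Sum>j<2 * n. res j * pole j ^ (n - 1)) = 0"
    "(\<Sum>j<2 * n. res j * pole j ^ (2 * n - 2)) = 0"
    using sum_res_moment[of 0] sum_res_moment[of "n - 1"] sum_res_moment[of "2 * n - 2"] n_ge by auto
  have "complex_of_real (\<Sum>j<2 * n. weight j * dir j $ k) = 0" for k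
    using exhaust_3[of k]
    by (auto simp: weight_dir_components sum.distrib sum_subtractf sum_negf s[unfolded One_nat_def]
        simp flip: sum_divide_distrib sum_distrib_left simp del: of_real_mult)
  then show ?thesis
    by (simp add: vec_eq_iff del: of_real_sum)
qed

text \<open>Modulo \<open>2 * pi\<close>, \<open>\<theta>\<close> lies between two neighbouring
  ends, each at angular distance at least \<open>\<beta>\<close>. Their gap is then at least
  \<open>2 * \<beta>\<close>, and the gap condition applies.\<close>

lemma angle_gap:
  assumes "\<And>j. j < 2 * n \<Longrightarrow> cos (\<theta> - \<alpha> j) \<le> cos \<beta>" "0 \<le> \<beta>" "\<beta> \<le> pi"
  shows "real (n - 1) * \<beta> < pi"
proof -
  obtain k :: int where k: "0 \<le> \<theta> - 2 * pi * of_int k" "\<theta> - 2 * pi * of_int k < 2 * pi"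
    by (rule angle_mod_2pi)
  define t where "t = \<theta> - 2 * pi * of_int k"
  have t: "0 \<le> t" "t < 2 * pi"
    using k by (simp_all add: t_def)
  have "cos (t - a) = cos (\<theta> - a)" for a
  proof -
    have "t - a = (\<theta> - a) - 2 * pi * of_int k"
      by (simp add: t_def)
    then show ?thesis
      by (simp only: cos_diff[of "\<theta> - a"] sin_int_2pin cos_int_2pin)
  qed
  then have le: "cos (t - \<alpha> j) \<le> cos \<beta>" if "j < 2 * n" for j
    using assms(1) that by simp
  \<comment> \<open>The first end beyond \<open>t\<close>: it exists since
    \<open>\<alpha> (2 * n) = 2 * pi > t\<close>, and \<open>m > 0\<close> since
    \<open>\<alpha> 0 = 0 \<le> t\<close>.\<close>
  define m where "m = (LEAST m. t < \<alpha> m)"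
  have m: "t < \<alpha> m" "m \<le> 2 * n"
    unfolding m_def using t(2) \<alpha>_end by (auto intro: LeastI[of _ "2 * n"] Least_le)
  then obtain j where j: "m = Suc j"
    using t(1) \<alpha>_0 by (cases m) auto
  then have "\<alpha> j \<le> t"
    using not_less_Least[of j "\<lambda>m. t < \<alpha> m"] by (simp add: m_def not_less)
  have "j < 2 * n"
    using m j by simp
  have "\<beta> \<le> t - \<alpha> j"
  proof (rule cos_le_cos_imp_bounds(1))
  qed (use \<open>\<alpha> j \<le> t\<close> le[OF \<open>j < 2 * n\<close>] t \<alpha>_bounds[OF \<open>j < 2 * n\<close>] assms in auto)
  moreover have "\<beta> \<le> \<alpha> (Suc j) - t"
  proof (rule cos_le_cos_imp_bounds(1))
    show "cos (\<alpha> (Suc j) - t) \<le> cos \<beta>"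
    proof (cases "Suc j < 2 * n")
      case True
      then show ?thesis
        using le[OF True] cos_minus[of "t - \<alpha> (Suc j)"] by simp
    next
      \<comment> \<open>Here the right neighbour is the end \<open>0\<close> reached after a full
        turn.\<close>
      case False
      then have "Suc j = 2 * n"
        using \<open>j < 2 * n\<close> by simp
      then show ?thesis
        using le[of 0] n_ge \<alpha>_0 \<alpha>_end by (simp add: cos_diff)
    qed
    show "\<alpha> (Suc j) - t \<le> 2 * pi"
      using \<alpha>_bounds[of "Suc j"] t \<alpha>_end \<open>j < 2 * n\<close> by (cases "Suc j = 2 * n") auto
  qed (use m j assms in auto)
  ultimately have "2 * \<beta> < 2 * pi / (real n - 1)"
    using gap[OF \<open>j < 2 * n\<close>] by linarith
  then show ?thesis
    using n_ge by (simp add: field_simps of_nat_diff)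
qed

text \<open>With \<open>q = cis \<beta>\<close> or \<open>q = cis (- \<beta>)\<close>, the
  hypothesis forces \<open>sin ((n - 1) * \<beta>) = 0\<close>. As \<open>angle_gap\<close> bounds
  \<open>(n - 1) * \<beta>\<close> by \<open>pi\<close>, only \<open>\<beta> = 0\<close> remains.
  This serves both in the interior and on the boundary of the domain.\<close>

lemma power_eq_cnj_power_imp_real:
  assumes "cmod q = 1" "\<And>j. j < 2 * n \<Longrightarrow> cos (\<theta> - \<alpha> j) \<le> Re q" "q ^ (n - 1) = cnj q ^ (n - 1)"
  shows "q = cnj q"
proof -
  define \<beta> where "\<beta> = arccos (Re q)"
  have Re: "\<bar>Re q\<bar> \<le> 1"
    using abs_Re_le_cmod[of q] assms(1) by simp
  then have cos: "cos \<beta> = Re q" and \<beta>: "0 \<le> \<beta>" "\<beta> \<le> pi"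
    by (auto simp: \<beta>_def abs_le_iff intro!: arccos_lbound arccos_ubound cos_arccos)
  have lt: "real (n - 1) * \<beta> < pi"
    using angle_gap[of \<theta> \<beta>] assms(2) \<beta> by (simp add: cos)
  have "(Im q)\<^sup>2 = (sin \<beta>)\<^sup>2"
    using assms(1) cos by (simp add: cmod_def sin_squared_eq)
  then have "q = cis \<beta> \<or> q = cis (- \<beta>)"
    by (auto simp: complex_eq_iff cos power2_eq_iff)
  then have "q ^ (n - 1) = cis (real (n - 1) * \<beta>) \<or> q ^ (n - 1) = cis (- (real (n - 1) * \<beta>))"
    by (auto simp: Complex.DeMoivre)
  moreover have "Im (q ^ (n - 1)) = 0"
    using assms(3) by (simp add: complex_eq_iff flip: complex_cnj_power)
  ultimately have "sin (real (n - 1) * \<beta>) = 0"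
    by auto
  then have "\<beta> = 0"
    using sin_gt_zero[OF _ lt] \<beta>(1) n_ge by (cases "\<beta> = 0") auto
  then show ?thesis
    using \<open>q = cis \<beta> \<or> q = cis (- \<beta>)\<close> by auto
qed

end

section \<open>The extension as a sum of logarithms\<close>

text \<open>The two spacelike components suffice: if they vanish, \<open>c = h z * d\<close> is
  minus the conjugate of \<open>(g z)\<^sup>2 * c\<close>, and comparing moduli gives
  \<open>c = 0\<close>.\<close>

lemma inj_Re_weierstrass_form:
  assumes "cmod (g z) < 1" "h z \<noteq> 0"
  shows "inj (Re_form (weierstrass_form g h z))"
proof -
  have "d = 0" if "Re_form (weierstrass_form g h z) d = 0" for d
  proof -
    define c where "c = h z * d"
    define w where "w = (g z)\<^sup>2"
    have comp: "Re (weierstrass_form g h z $ k * d) = 0" for k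
      using that by (simp add: Re_form_def vec_eq_iff)
    have "Re ((1 + w) * c) = 0" "Re (\<i> * (1 - w) * c) = 0"
      using comp[of 2] comp[of 3] by (simp_all only: c_def w_def weierstrass_form_def vector_3 mult.assoc)
    then have "c = - cnj (w * c)"
      by (simp add: complex_eq_iff algebra_simps)
    then have "cmod c = cmod w * cmod c"
      by (metis complex_mod_cnj norm_minus_cancel norm_mult)
    moreover have "cmod w < 1"
      using assms(1) by (simp add: w_def norm_power power_less_one_iff abs_square_less_1)
    ultimately have "c = 0"
      by auto
    then show "d = 0"
      using assms(2) by (simp add: c_def)
  qed
  moreover have "linear (Re_form v)" for v
    by (auto intro!: linearI simp: Re_form_def vec_eq_iff algebra_simps)
  ultimately show ?thesis
    by (simp add: linear_injective_0)
qed

section \<open>Passing between the disk and the coordinates \<open>(u, \<theta>)\<close>\<close>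

lemma radius_of_height:
  fixes u :: real
  assumes "u > 1"
  obtains r where "0 < r" "r < 1" "(r + inverse r) / 2 = u" "r < inverse u"
proof -
  \<comment> \<open>The radius is \<open>inverse (u + w) = u - w\<close>; the first form gives the
    bound by \<open>inverse u\<close>, which later puts the points with \<open>u > 2\<close> into a
    smaller disk.\<close>
  define w where "w = sqrt (u\<^sup>2 - 1)"
  have "u\<^sup>2 - 1 > 0"
    using assms by (simp add: power2_eq_square less_1_mult)
  then have w: "w > 0" "w\<^sup>2 = u\<^sup>2 - 1"
    by (simp_all add: w_def)
  have "(u - w) * (u + w) = 1"
    using w(2) by (simp add: algebra_simps power2_eq_square)
  then have r: "inverse (u + w) = u - w"
    using w(1) assms by (intro inverse_unique) (simp add: mult.commute)
  have "inverse (u + w) < inverse u"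
    using w(1) assms by (intro less_imp_inverse_less) auto
  moreover from this have "inverse (u + w) < 1"
    by (rule less_trans) (use assms in \<open>simp add: inverse_less_1_iff\<close>)
  moreover have "(inverse (u + w) + inverse (inverse (u + w))) / 2 = u"
    using r by (subst inverse_inverse_eq) simp
  ultimately show ?thesis
    using w(1) assms by (intro that[of "inverse (u + w)"]) auto
qed

lemma iota_rcis:
  assumes "0 < r"
  shows "iota (rcis r \<theta>) = chart_fin ((r + inverse r) / 2, \<theta>)"
proof -
  have "cis (Arg (rcis r \<theta>)) = cis \<theta>"
    using assms by (subst cis_Arg) (auto simp: sgn_eq rcis_def norm_mult)
  then obtain k :: int where "Arg (rcis r \<theta>) - \<theta> = 2 * pi * of_int k"
    by (rule cis_eq_cisE)
  then have "angle_of (Arg (rcis r \<theta>)) = angle_of \<theta>"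
    by (auto simp: angle.abs_eq_iff)
  then show ?thesis
    using assms by (simp add: iota_def chart_fin_def)
qed

lemma cmod_rcis_minus_cis:
  assumes "0 < r"
  shows "(cmod (rcis r \<theta> - cis a))\<^sup>2 = 2 * r * ((r + inverse r) / 2 - cos (\<theta> - a))"
proof -
  have "(cmod (rcis r \<theta> - cis a))\<^sup>2 =
      r\<^sup>2 * ((cos \<theta>)\<^sup>2 + (sin \<theta>)\<^sup>2) + ((cos a)\<^sup>2 + (sin a)\<^sup>2) - 2 * r * (cos \<theta> * cos a + sin \<theta> * sin a)"
    unfolding cmod_power2
    by (simp add: power2_eq_square algebra_simps
        del: sin_cos_squared_add sin_cos_squared_add2 sin_cos_squared_add3)
  also have "\<dots> = r\<^sup>2 + 1 - 2 * r * cos (\<theta> - a)"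
    by (simp add: cos_diff)
  also have "\<dots> = 2 * r * ((r + inverse r) / 2 - cos (\<theta> - a))"
    using assms by (simp add: field_simps power2_eq_square)
  finally show ?thesis .
qed

lemma bounded_linear_Complex: "bounded_linear (\<lambda>p. Complex (fst p) (snd p))"
proof -
  have "(\<lambda>p. Complex (fst p) (snd p)) = (\<lambda>p. of_real (fst p) + \<i> * of_real (snd p))"
    by (auto simp: complex_eq_iff)
  then show ?thesis
    by (auto intro!: bounded_linear_intros bounded_linear_compose[OF bounded_linear_of_real]
        bounded_linear_const_mult)
qed

lemma norm_Complex_pair: "cmod (Complex (fst p) (snd p)) = norm p"
  by (cases p) (simp add: norm_Pair cmod_def)

context kobayashi_data
begin

lemma mem_dom_fin: "(u, \<theta>) \<in> dom_fin n \<alpha> \<longleftrightarrow> (\<forall>j<2 * n. cos (\<theta> - \<alpha> j) < u)"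
  using n_ge by (subst dom_fin_eq) (auto simp: lessThan_empty_iff)

lemma open_dom_fin: "open (dom_fin n \<alpha>)"
proof -
  have "dom_fin n \<alpha> = (\<Inter>j\<in>{..<2 * n}. {p. cos (snd p - \<alpha> j) < fst p})"
    by (auto simp: mem_dom_fin)
  then show ?thesis
    by (auto intro!: open_INT open_Collect_less continuous_intros)
qed

lemma not_end_if_cmod_less_1: "cmod z < 1 \<Longrightarrow> z \<notin> kob_ends n \<alpha>"
  by (auto simp: kob_ends_def)

definition log_sum :: "real \<times> real \<Rightarrow> real^3"
  where "log_sum p = (\<Sum>j<2 * n. (weight j * ln (fst p - cos (snd p - \<alpha> j))) *\<^sub>R dir j)"

text \<open>By the partial fractions both sides have the same derivative, and the unit disk is
  convex and free of ends.\<close>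

lemma kobayashi_surface_on_disk:
  assumes "kobayashi_surface n \<alpha> f"
  obtains C where "\<And>z. cmod z < 1 \<Longrightarrow>
    f (Fin z) = (\<Sum>j<2 * n. (2 * weight j * ln (cmod (z - pole j))) *\<^sub>R dir j) + C"
proof -
  let ?S = "\<lambda>z. \<Sum>j<2 * n. (2 * weight j * ln (cmod (z - pole j))) *\<^sub>R dir j"
  have D: "((\<lambda>z. f (Fin z) - ?S z) has_derivative (\<lambda>d. 0)) (at z)" if "cmod z < 1" for z
  proof -
    have "((\<lambda>z. f (Fin z)) has_derivative Re_form (weierstrass_form (kob_g n) (kob_omega n \<alpha>) z)) (at z)"
      using assms not_end_if_cmod_less_1[OF that] by (simp add: kobayashi_surface_def maxface_on_sphere_def)
    moreover have "(?S has_derivative (\<lambda>d. \<Sum>j<2 * n. (2 * weight j * Re (d / (z - pole j))) *\<^sub>R dir j)) (at z)"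
      using that by (intro has_derivative_sum has_derivative_scaleR_left has_derivative_mult_right
          ln_cmod_has_derivative) simp
    moreover have "Re_form (weierstrass_form (kob_g n) (kob_omega n \<alpha>) z) d =
        (\<Sum>j<2 * n. (2 * weight j * Re (d / (z - pole j))) *\<^sub>R dir j)" for d
    proof -
      have "Re (of_real t * w) = t * Re w" for t w
        by simp
      moreover have "weierstrass_form (kob_g n) (kob_omega n \<alpha>) z $ k * d =
          (\<Sum>j<2 * n. of_real (2 * (weight j * dir j $ k)) * (d / (z - pole j)))" for k
        unfolding weierstrass_form_eq[OF not_end_if_cmod_less_1[OF that]] sum_distrib_right
        by (intro sum.cong) auto
      ultimately have "Re (weierstrass_form (kob_g n) (kob_omega n \<alpha>) z $ k * d) =
          (\<Sum>j<2 * n. 2 * (weight j * dir j $ k) * Re (d / (z - pole j)))" for k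
        by (simp only: Re_sum)
      then show ?thesis
        unfolding vec_eq_iff Re_form_def vec_lambda_beta by (auto simp: mult_ac)
    qed
    ultimately show ?thesis
      by (auto intro!: has_derivative_eq_rhs[OF has_derivative_diff])
  qed
  have "\<exists>C. \<forall>z\<in>ball 0 1. f (Fin z) - ?S z = C"
    by (rule has_derivative_zero_constant[OF convex_ball has_derivative_at_withinI[OF D]]) simp
  then obtain C where "\<And>z. cmod z < 1 \<Longrightarrow> f (Fin z) - ?S z = C"
    by auto
  then show ?thesis
    using that[of C] by (simp add: diff_eq_eq add.commute)
qed

text \<open>The factor \<open>2 * r\<close> in the squared distance contributes
  \<open>ln (2 * r)\<close> to every term; this drops out because the vectors
  \<open>weight j *\<^sub>R dir j\<close> add up to zero.\<close>

lemma log_sum_polar: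
  assumes "0 < r" "r < 1"
  shows "(\<Sum>j<2 * n. (2 * weight j * ln (cmod (rcis r \<theta> - pole j))) *\<^sub>R dir j) =
    log_sum ((r + inverse r) / 2, \<theta>)"
proof -
  define u where "u = (r + inverse r) / 2"
  have "2 * ln (cmod (rcis r \<theta> - pole j)) = ln (2 * r) + ln (u - cos (\<theta> - \<alpha> j))" for j
  proof -
    have pos: "cmod (rcis r \<theta> - pole j) > 0"
      using assms by (auto dest: arg_cong[of _ _ cmod])
    have "2 * ln (cmod (rcis r \<theta> - pole j)) = ln ((cmod (rcis r \<theta> - pole j))\<^sup>2)"
      using pos by (simp add: ln_realpow)
    also have "\<dots> = ln (2 * r * (u - cos (\<theta> - \<alpha> j)))"
      using assms by (simp add: cmod_rcis_minus_cis u_def)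
    also have "\<dots> = ln (2 * r) + ln (u - cos (\<theta> - \<alpha> j))"
    proof -
      have "0 < 2 * r * (u - cos (\<theta> - \<alpha> j))"
        using zero_less_power[OF pos, of 2] unfolding cmod_rcis_minus_cis[OF assms(1)] u_def .
      then show ?thesis
        using assms by (intro ln_mult_pos) (auto simp: zero_less_mult_iff)
    qed
    finally show ?thesis .
  qed
  then have *: "(2 * weight j * ln (cmod (rcis r \<theta> - pole j))) *\<^sub>R dir j =
      ln (2 * r) *\<^sub>R (weight j *\<^sub>R dir j) + (weight j * ln (u - cos (\<theta> - \<alpha> j))) *\<^sub>R dir j" for j
    by (simp add: mult.assoc[of 2] mult.left_commute[of 2] distrib_left scaleR_left_distrib mult.commute)
  have "(\<Sum>j<2 * n. (2 * weight j * ln (cmod (rcis r \<theta> - pole j))) *\<^sub>R dir j) =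
      ln (2 * r) *\<^sub>R (\<Sum>j<2 * n. weight j *\<^sub>R dir j) + log_sum (u, \<theta>)"
    unfolding * log_sum_def sum.distrib scaleR_right.sum fst_conv snd_conv ..
  then show ?thesis
    by (simp add: sum_weight_dir u_def)
qed

text \<open>On a line of constant \<open>\<theta>\<close> the difference is a power series in
  \<open>u\<close> near each point above the lower endpoint \<open>l\<close>, and it is zero for
  \<open>u > 1\<close>, where \<open>F\<close> is given by \<open>f\<close> on the disk. The
  constant \<open>C\<close> comes from the disk and so is the same for all
  \<open>\<theta>\<close>.\<close>

lemma extension_on_chart_fin:
  assumes "kobayashi_surface n \<alpha> f" "analytic_extension n \<alpha> f F"
  obtains C where "\<And>p. p \<in> dom_fin n \<alpha> \<Longrightarrow> (F \<circ> chart_fin) p = log_sum p + C"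
proof -
  obtain C where C: "\<And>z. cmod z < 1 \<Longrightarrow>
      f (Fin z) = (\<Sum>j<2 * n. (2 * weight j * ln (cmod (z - pole j))) *\<^sub>R dir j) + C"
    using kobayashi_surface_on_disk[OF assms(1)] by blast
  have "(F (chart_fin (u, \<theta>)) - (log_sum (u, \<theta>) + C)) $ k = 0" if dom: "(u, \<theta>) \<in> dom_fin n \<alpha>" for u \<theta> k
  proof -
    define l where "l = Max ((\<lambda>j. cos (\<theta> - \<alpha> j)) ` {..<2 * n})"
    have le_l: "cos (\<theta> - \<alpha> j) \<le> l" if "j \<in> {..<2 * n}" for j
      unfolding l_def using that by (intro Max_ge) auto
    have gt_l: "(x, \<theta>) \<in> dom_fin n \<alpha> \<longleftrightarrow> x > l" for x
      by (simp add: dom_fin_eq l_def)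
    show ?thesis
    proof (rule vanishes_right_of_power_series[where l = l and b = 1 and x = u
          and h = "\<lambda>u. (F (chart_fin (u, \<theta>)) - (log_sum (u, \<theta>) + C)) $ k"])
      fix x :: real assume "x > 1"
      then obtain r where r: "0 < r" "r < 1" "(r + inverse r) / 2 = x"
        by (rule radius_of_height)
      have "rcis r \<theta> \<in> cball 0 1 - kob_ends n \<alpha>"
        using r not_end_if_cmod_less_1[of "rcis r \<theta>"] by simp
      then have "F (iota (rcis r \<theta>)) = f (Fin (rcis r \<theta>))"
        using assms(2) unfolding analytic_extension_def by blast
      then show "(F (chart_fin (x, \<theta>)) - (log_sum (x, \<theta>) + C)) $ k = 0"
        using r by (simp add: iota_rcis C log_sum_polar)
    next
      fix a assume "a > l"
      have "real_analytic_on2 (F \<circ> chart_fin) (dom_fin n \<alpha>)"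
        using assms(2) by (simp add: analytic_extension_def analytic_on_Omega_def)
      then obtain c \<epsilon> where "\<epsilon> > 0" and c: "\<And>x. \<bar>x - a\<bar> < \<epsilon> \<Longrightarrow>
          (\<lambda>i. (x - a) ^ i *\<^sub>R c i) sums (F \<circ> chart_fin) (x, \<theta>)"
        using real_analytic_on2_fst_series[of "F \<circ> chart_fin" _ a \<theta>] gt_l \<open>a > l\<close> by blast
      obtain d \<delta> where "\<delta> > 0" and d: "\<And>x. \<bar>x - a\<bar> < \<delta> \<Longrightarrow> (\<lambda>i. d i * (x - a) ^ i) sums
          ((\<Sum>j<2 * n. (weight j * dir j $ k) * ln (x - cos (\<theta> - \<alpha> j))) + C $ k)"
        using sum_ln_power_series[of "{..<2 * n}" "\<lambda>j. cos (\<theta> - \<alpha> j)" l a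
            "\<lambda>j. weight j * dir j $ k" "C $ k"] le_l \<open>a > l\<close> by blast
      have "(\<lambda>i. (c i $ k - d i) * (x - a) ^ i) sums (F (chart_fin (x, \<theta>)) - (log_sum (x, \<theta>) + C)) $ k"
        if "\<bar>x - a\<bar> < min \<epsilon> \<delta>" for x
      proof -
        have "(\<lambda>i. ((x - a) ^ i *\<^sub>R c i) $ k) sums (F (chart_fin (x, \<theta>)) $ k)"
          using bounded_linear.sums[OF bounded_linear_vec_nth c[of x]] that by simp
        from sums_diff[OF this d[of x]] show ?thesis
          using that by (simp add: log_sum_def algebra_simps)
      qed
      then show "\<exists>c. \<exists>\<epsilon>>0. \<forall>x. \<bar>x - a\<bar> < \<epsilon> \<longrightarrow>
          (\<lambda>i. c i * (x - a) ^ i) sums ((F (chart_fin (x, \<theta>)) - (log_sum (x, \<theta>) + C)) $ k)"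
        using \<open>\<epsilon> > 0\<close> \<open>\<delta> > 0\<close>
        by (intro exI[of _ "\<lambda>i. c i $ k - d i"] exI[of _ "min \<epsilon> \<delta>"]) simp
    qed (use dom gt_l in auto)
  qed
  then have "F (chart_fin p) = log_sum p + C" if "p \<in> dom_fin n \<alpha>" for p
    using that by (cases p) (simp add: vec_eq_iff)
  then show ?thesis
    using that by simp
qed

section \<open>The differential\<close>

lemma log_sum_has_derivative:
  assumes "(u, \<theta>) \<in> dom_fin n \<alpha>"
  shows "(log_sum has_derivative (\<lambda>p. \<Sum>j<2 * n.
    (weight j * ((fst p + snd p * sin (\<theta> - \<alpha> j)) / (u - cos (\<theta> - \<alpha> j)))) *\<^sub>R dir j)) (at (u, \<theta>))"
  unfolding log_sum_def[abs_def]
proof (intro has_derivative_sum has_derivative_scaleR_left has_derivative_mult_right)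
  fix j assume "j \<in> {..<2 * n}"
  then have "u - cos (\<theta> - \<alpha> j) > 0"
    using assms by (simp add: mem_dom_fin)
  then show "((\<lambda>p. ln (fst p - cos (snd p - \<alpha> j))) has_derivative
      (\<lambda>p. (fst p + snd p * sin (\<theta> - \<alpha> j)) / (u - cos (\<theta> - \<alpha> j)))) (at (u, \<theta>))"
    by (auto intro!: derivative_eq_intros simp: field_simps)
qed

text \<open>As a function of \<open>p = cis (\<alpha> j)\<close> the coefficient of
  \<open>weight j *\<^sub>R dir j\<close> is rational with poles at \<open>x\<close> and
  \<open>y\<close>. The partial fractions of the form, read at \<open>X = x\<close> and
  \<open>X = y\<close>, turn the vanishing of the sum into two linear equations, for the exponents
  \<open>0\<close> and \<open>n - 1\<close>. They are independent because \<open>x ^ (n - 1)\<close>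
  and \<open>y ^ (n - 1)\<close> differ; for \<open>x = y\<close> a double pole takes over.\<close>

lemma log_sum_differential_injective:
  fixes a b :: real
  assumes dom: "(u, \<theta>) \<in> dom_fin n \<alpha>"
    and zero: "(\<Sum>j<2 * n.
      (weight j * ((a + b * sin (\<theta> - \<alpha> j)) / (u - cos (\<theta> - \<alpha> j)))) *\<^sub>R dir j) = 0"
  shows "a = 0 \<and> b = 0"
proof -
  define s where "s j = (a + b * sin (\<theta> - \<alpha> j)) / (u - cos (\<theta> - \<alpha> j))" for j
  define \<zeta> where "\<zeta> = cis \<theta>"
  \<comment> \<open>The roots of \<open>t\<^sup>2 - 2 * u * t + 1\<close>; the complex square root
    covers \<open>u < 1\<close> as well.\<close>
  define q where "q = u + csqrt (u\<^sup>2 - 1)"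
  define q' where "q' = u - csqrt (u\<^sup>2 - 1)"
  define x where "x = \<zeta> * q"
  define y where "y = \<zeta> * q'"
  \<comment> \<open>At an end \<open>N\<close> is \<open>2 * pole j * \<zeta>\<close> times
    \<open>a + b * sin (\<theta> - \<alpha> j)\<close>.\<close>
  define N where "N p = 2 * of_real a * \<zeta> * p - \<i> * of_real b * (x * y - p\<^sup>2)" for p
  let ?Q = "kob_omega n \<alpha>"
  have q: "q * q' = 1" "q + q' = 2 * of_real u"
  proof -
    have "q * q' = (of_real u)\<^sup>2 - (csqrt (u\<^sup>2 - 1))\<^sup>2"
      by (simp add: q_def q'_def power2_eq_square algebra_simps)
    then show "q * q' = 1"
      by simp
  qed (simp add: q_def q'_def)
  have nz [simp]: "\<zeta> \<noteq> 0" "x \<noteq> 0" "y \<noteq> 0"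
    using q(1) by (auto simp: \<zeta>_def x_def y_def)
  have xy: "x * y = \<zeta>\<^sup>2" "x + y = 2 * of_real u * \<zeta>"
    using q by (simp_all add: x_def y_def power2_eq_square mult_ac flip: distrib_left)
  have cs: "2 * pole j * \<zeta> * of_real (cos (\<theta> - \<alpha> j)) = \<zeta>\<^sup>2 + (pole j)\<^sup>2"
    "2 * pole j * \<zeta> * of_real (sin (\<theta> - \<alpha> j)) = - \<i> * (\<zeta>\<^sup>2 - (pole j)\<^sup>2)" for j
  proof -
    have "2 * of_real (cos t) = cis t + cis (- t)" "2 * of_real (sin t) = - \<i> * (cis t - cis (- t))" for t
      by (simp_all add: complex_eq_iff)
    note * = this(1)[of "\<theta> - \<alpha> j"] this(2)[of "\<theta> - \<alpha> j"]
    have **: "pole j * \<zeta> * cis (\<theta> - \<alpha> j) = \<zeta>\<^sup>2" "pole j * \<zeta> * cis (- (\<theta> - \<alpha> j)) = (pole j)\<^sup>2"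
      by (simp_all add: \<zeta>_def cis_mult power2_eq_square)
    show "2 * pole j * \<zeta> * of_real (cos (\<theta> - \<alpha> j)) = \<zeta>\<^sup>2 + (pole j)\<^sup>2"
      using *(1) ** by algebra
    show "2 * pole j * \<zeta> * of_real (sin (\<theta> - \<alpha> j)) = - \<i> * (\<zeta>\<^sup>2 - (pole j)\<^sup>2)"
      using *(2) ** by algebra
  qed
  \<comment> \<open>\<open>x\<close> and \<open>y\<close> are the zeros of \<open>u - cos (\<theta> - \<alpha>)\<close> as a function of \<open>p = cis \<alpha>\<close>; they
    are the points \<open>r cis \<theta>\<close>, \<open>cis \<theta> / r\<close> if \<open>u > 1\<close>, and the two null coordinates of the
    timelike part if \<open>u < 1\<close>.\<close>
  have W: "(pole j - x) * (pole j - y) = - 2 * pole j * \<zeta> * of_real (u - cos (\<theta> - \<alpha> j))" for j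
    unfolding of_real_diff using cs(1)[of j] xy by algebra
  have ne: "pole j \<noteq> x \<and> pole j \<noteq> y" if "j < 2 * n" for j
  proof -
    have "(pole j - x) * (pole j - y) \<noteq> 0"
      using dom that by (auto simp: W mem_dom_fin simp del: of_real_diff)
    then show ?thesis
      by auto
  qed
  then have not_end: "x \<notin> kob_ends n \<alpha>" "y \<notin> kob_ends n \<alpha>"
    by (auto simp: kob_ends_def)
  have Q: "?Q x \<noteq> 0" "?Q y \<noteq> 0"
    using ne by (auto simp: kob_omega_def kob_Lambda_def)
  have s_eq: "of_real (s j) = - (N (pole j) / ((pole j - x) * (pole j - y)))" if "j < 2 * n" for j
  proof -
    have "u - cos (\<theta> - \<alpha> j) \<noteq> 0"
      using dom that by (auto simp: mem_dom_fin)
    moreover have "N (pole j) = 2 * pole j * \<zeta> * of_real (a + b * sin (\<theta> - \<alpha> j))"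
      unfolding N_def xy of_real_add of_real_mult using cs(2)[of j] by algebra
    ultimately show ?thesis
      unfolding W s_def by (simp add: field_simps del: of_real_diff of_real_add of_real_mult)
  qed
  have moments: "(\<Sum>j<2 * n. res j * pole j ^ m * of_real (s j)) = 0" if "m = 0 \<or> m = n - 1" for m
  proof -
    have "(\<Sum>j<2 * n. weight j * dir j $ k * s j) = 0" for k
      using arg_cong[OF zero, of "\<lambda>v. v $ k"] by (simp add: s_def mult_ac)
    then have z: "(\<Sum>j<2 * n. of_real (weight j * dir j $ k) * complex_of_real (s j)) = 0" for k
      by (simp flip: of_real_mult of_real_sum)
    have "(\<Sum>j<2 * n. res j * pole j ^ (n - 1) * of_real (s j)) = - (\<Sum>j<2 * n. of_real (weight j * dir j $ 1) * of_real (s j))"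
      by (simp add: weight_dir_components sum_negf del: of_real_mult)
    \<comment> \<open>The second component minus \<open>\<i>\<close> times the third isolates
      \<open>res j\<close>.\<close>
    moreover have "(\<Sum>j<2 * n. res j * of_real (s j)) = (\<Sum>j<2 * n. of_real (weight j * dir j $ 2) * of_real (s j))
        - \<i> * (\<Sum>j<2 * n. of_real (weight j * dir j $ 3) * of_real (s j))"
      unfolding sum_distrib_left sum_subtractf[symmetric]
      by (intro sum.cong) (auto simp: weight_dir_components field_simps simp del: of_real_mult)
    ultimately show ?thesis
      using that by (auto simp: z simp del: of_real_mult)
  qed
  have res0: "(\<Sum>j<2 * n. res j * pole j ^ m) = 0" if "m = 0 \<or> m = n - 1" for m
    using sum_res_moment[of m] that n_ge by auto
  have T: "(\<Sum>j<2 * n. res j * pole j ^ m / (pole j - X)) = - (X ^ m * ?Q X)"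
    if "m < 2 * n" "X \<notin> kob_ends n \<alpha>" for m X
  proof -
    have "res j * pole j ^ m / (pole j - X) = - (res j * pole j ^ m / (X - pole j))" for j
      by (metis minus_diff_eq minus_divide_right)
    then show ?thesis
      using sum_res_over[OF that] by (simp add: sum_negf)
  qed
  show ?thesis
  proof (cases "x = y")
    case False
    define A where "A = N x / (x - y)"
    define A' where "A' = N y / (x - y)"
    \<comment> \<open>The constant term of the expansion is annihilated by the moment identity
      \<open>res0\<close>.\<close>
    have eq: "A * (x ^ m * ?Q x) = A' * (y ^ m * ?Q y)" if m: "m = 0 \<or> m = n - 1" for m
    proof -
      have "res j * pole j ^ m * of_real (s j) = - (\<i> * of_real b * (res j * pole j ^ m)
          + A * (res j * pole j ^ m / (pole j - x)) - A' * (res j * pole j ^ m / (pole j - y)))"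
        if "j < 2 * n" for j
      proof -
        have s: "of_real (s j) = - (\<i> * of_real b + A / (pole j - x) - A' / (pole j - y))"
          unfolding s_eq[OF that] A_def A'_def N_def
          using ne[OF that] False by (subst reciprocal_quadratic_expand) auto
        show ?thesis
          unfolding s by (simp add: algebra_simps)
      qed
      then have "(\<Sum>j<2 * n. res j * pole j ^ m * of_real (s j)) =
          - (\<i> * of_real b * (\<Sum>j<2 * n. res j * pole j ^ m)
          + A * (\<Sum>j<2 * n. res j * pole j ^ m / (pole j - x))
          - A' * (\<Sum>j<2 * n. res j * pole j ^ m / (pole j - y)))"
        by (simp add: sum_negf sum.distrib sum_subtractf del: times_divide_eq_right flip: sum_distrib_left)
      moreover have "m < 2 * n"
        using m n_ge by auto
      ultimately show ?thesis
        using not_end by (simp add: moments[OF m] res0[OF m] T)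
    qed
    \<comment> \<open>The Gauss map separates \<open>x\<close> and \<open>y\<close>: on the unit circle this is the gap condition.\<close>
    have "x ^ (n - 1) \<noteq> y ^ (n - 1)"
    proof
      assume "x ^ (n - 1) = y ^ (n - 1)"
      then have pow: "q ^ (n - 1) = q' ^ (n - 1)"
        by (simp add: x_def y_def power_mult_distrib)
      \<comment> \<open>Equal powers force equal moduli, and the product of the moduli is
        \<open>1\<close>. So \<open>q\<close> lies on the unit circle with real part
        \<open>u\<close>, the case governed by the gap condition.\<close>
      then have "cmod q ^ (n - 1) = cmod q' ^ (n - 1)"
        by (metis norm_power)
      then have "cmod q = cmod q'"
        using n_ge power_eq_imp_eq_base[of "cmod q" "n - 1" "cmod q'"] by auto
      moreover have "cmod q * cmod q' = 1"
        using q(1) by (metis norm_mult norm_one)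
      ultimately have "(cmod q)\<^sup>2 = 1"
        by (simp add: power2_eq_square)
      then have norm: "cmod q = 1"
        by (simp add: power2_eq_1_iff) (use norm_ge_zero[of q] in linarith)
      then have "q * cnj q = 1"
        by (simp add: complex_norm_square[symmetric])
      then have cnj: "q' = cnj q"
        using q(1) by (metis mult_cancel_left mult_zero_left zero_neq_one)
      then have "Re q = u"
        using arg_cong[OF q(2), of Re] by simp
      then have "q = cnj q"
        using norm pow cnj dom by (intro power_eq_cnj_power_imp_real[of q \<theta>]) (auto simp: mem_dom_fin less_imp_le)
      then show False
        using False cnj by (simp add: x_def y_def)
    qed
    moreover have "A * ?Q x * (x ^ (n - 1) - y ^ (n - 1)) = 0"
    proof -
      have "A * ?Q x * x ^ (n - 1) = A' * ?Q y * y ^ (n - 1)"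
        using eq[OF disjI2[OF refl]] by (simp only: mult_ac)
      moreover have "A * ?Q x = A' * ?Q y"
        using eq[OF disjI1[OF refl]] by simp
      ultimately show ?thesis
        by (simp only: right_diff_distrib diff_self)
    qed
    ultimately have "A = 0"
      using Q by simp
    then have "A' = 0"
      using eq[of 0] Q by simp
    have "N x = 0" "N y = 0"
      using \<open>A = 0\<close> \<open>A' = 0\<close> False by (simp_all add: A_def A'_def)
    moreover have "N x = x * (2 * of_real a * \<zeta> - \<i> * of_real b * (y - x))" "N y = y * (2 * of_real a * \<zeta> - \<i> * of_real b * (x - y))"
      by (simp_all add: N_def algebra_simps power2_eq_square)
    ultimately have lin: "2 * of_real a * \<zeta> - \<i> * of_real b * (y - x) = 0" "2 * of_real a * \<zeta> - \<i> * of_real b * (x - y) = 0"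
      by auto
    have "4 * of_real a * \<zeta> = 0" "2 * \<i> * of_real b * (x - y) = 0"
      using lin by algebra+
    then show ?thesis
      using False by simp
  next
    case True
    \<comment> \<open>Here \<open>u\<^sup>2 = 1\<close>. \<open>N'\<close> is the derivative of
      \<open>N\<close> at the double root, and \<open>S m\<close> is the sum against the double
      pole, reduced to \<open>S 0\<close> by a recursion in \<open>m\<close>.\<close>
    define N' where "N' = 2 * of_real a * \<zeta> + 2 * \<i> * of_real b * x"
    define S where "S m = (\<Sum>j<2 * n. res j * pole j ^ m / (pole j - x)\<^sup>2)" for m
    have x2: "x\<^sup>2 = \<zeta>\<^sup>2"
      using xy(1) True by (simp add: power2_eq_square)
    have S: "S m = x ^ m * S 0 - of_nat m * x ^ (m - 1) * ?Q x" if "m < 2 * n" for m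
      using that
    proof (induction m)
      case (Suc m)
      have "res j * pole j ^ Suc m / (pole j - x)\<^sup>2 =
          x * (res j * pole j ^ m / (pole j - x)\<^sup>2) + res j * pole j ^ m / (pole j - x)" if "j < 2 * n" for j
        using ne[OF that] by (simp add: divide_simps) (simp add: algebra_simps power2_eq_square)
      then have "S (Suc m) = x * S m + (\<Sum>j<2 * n. res j * pole j ^ m / (pole j - x))"
        by (simp add: S_def sum.distrib del: times_divide_eq_right flip: sum_distrib_left)
      then have "S (Suc m) = x * S m - x ^ m * ?Q x"
        using Suc.prems not_end by (simp add: T)
      also have "\<dots> = x ^ Suc m * S 0 - x * (of_nat m * x ^ (m - 1)) * ?Q x - x ^ m * ?Q x"
        by (subst Suc.IH) (use Suc.prems in \<open>simp_all add: algebra_simps\<close>)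
      also have "x * (of_nat m * x ^ (m - 1)) = of_nat m * x ^ m"
        by (cases m) auto
      finally show ?case
        by (simp add: algebra_simps)
    qed simp
    have eq: "N x * S m = N' * (x ^ m * ?Q x)" if m: "m = 0 \<or> m = n - 1" for m
    proof -
      have "res j * pole j ^ m * of_real (s j) = - (N x * (res j * pole j ^ m / (pole j - x)\<^sup>2)
          + N' * (res j * pole j ^ m / (pole j - x)) + \<i> * of_real b * (res j * pole j ^ m))"
        if "j < 2 * n" for j
      proof -
        have "N (pole j) = N x + N' * (pole j - x) + \<i> * of_real b * (pole j - x)\<^sup>2"
          by (simp add: N_def N'_def algebra_simps power2_eq_square)
        then have s: "of_real (s j) = - (N x / (pole j - x)\<^sup>2 + N' / (pole j - x) + \<i> * of_real b)"
          unfolding s_eq[OF that] using ne[OF that] True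
          by (simp add: add_divide_distrib power2_eq_square)
        show ?thesis
          unfolding s by (simp add: algebra_simps)
      qed
      then have "(\<Sum>j<2 * n. res j * pole j ^ m * of_real (s j)) =
          - (N x * S m + N' * (\<Sum>j<2 * n. res j * pole j ^ m / (pole j - x))
          + \<i> * of_real b * (\<Sum>j<2 * n. res j * pole j ^ m))"
        by (simp add: S_def sum_negf sum.distrib sum_subtractf del: times_divide_eq_right flip: sum_distrib_left)
      moreover have "m < 2 * n"
        using m n_ge by auto
      ultimately show ?thesis
        using not_end by (simp add: moments[OF m] res0[OF m] T)
    qed
    \<comment> \<open>Subtracting the equation for \<open>n - 1\<close> from
      \<open>x ^ (n - 1)\<close> times the one for \<open>0\<close> removes both \<open>S 0\<close>
      and \<open>N'\<close>.\<close>
    have "N x * (of_nat (n - 1) * x ^ (n - 1 - 1) * ?Q x) = 0"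
    proof -
      have "S (n - 1) = x ^ (n - 1) * S 0 - of_nat (n - 1) * x ^ (n - 1 - 1) * ?Q x"
        using n_ge by (intro S) simp
      then have "of_nat (n - 1) * x ^ (n - 1 - 1) * ?Q x = x ^ (n - 1) * S 0 - S (n - 1)"
        by (simp only: diff_diff_eq2 add_diff_cancel_left')
      then have "N x * (of_nat (n - 1) * x ^ (n - 1 - 1) * ?Q x) =
          x ^ (n - 1) * (N x * S 0) - N x * S (n - 1)"
        by (simp only: right_diff_distrib mult.left_commute)
      also have "\<dots> = 0"
        unfolding eq[OF disjI1[OF refl]] eq[OF disjI2[OF refl]] by simp
      finally show ?thesis .
    qed
    then have "N x = 0"
      using Q n_ge by simp
    then have "N' = 0"
      using eq[of 0] Q by simp
    have "a = 0"
      using \<open>N x = 0\<close> True by (simp add: N_def power2_eq_square)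
    then show ?thesis
      using \<open>N' = 0\<close> by (simp add: N'_def)
  qed
qed

end

section \<open>Immersion and properness\<close>

context kobayashi_data
begin

section \<open>Charts, topology and a covering of the domain\<close>

lemma chart_fin_mem_Omega: "chart_fin p \<in> Omega n \<alpha> \<longleftrightarrow> p \<in> dom_fin n \<alpha>"
  by (simp add: dom_fin_def)

lemma chart_inf_eq: "chart_inf p = iota (Complex (fst p) (snd p))"
  by (simp add: chart_inf_def case_prod_unfold)

lemma chart_inf_mem_Omega:
  assumes "p \<in> dom_inf"
  shows "chart_inf p \<in> Omega n \<alpha>"
proof (cases "p = 0")
  case True
  then show ?thesis
    by (simp add: chart_inf_eq iota_def Omega_def complex_eq_iff)
next
  case False
  define z where "z = Complex (fst p) (snd p)"
  have z: "0 < cmod z" "cmod z < 1"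
    using False assms by (simp_all add: z_def norm_Complex_pair dom_inf_def)
  have "0 < (cmod z - 1)\<^sup>2"
    using z by simp
  then have "1 < (cmod z + inverse (cmod z)) / 2"
    using z by (simp add: field_simps power2_eq_square)
  then have "((cmod z + inverse (cmod z)) / 2, Arg z) \<in> dom_fin n \<alpha>"
    unfolding mem_dom_fin by (meson cos_le_one le_less_trans)
  moreover have "chart_inf p = chart_fin ((cmod z + inverse (cmod z)) / 2, Arg z)"
    using iota_rcis[OF z(1), of "Arg z"] by (simp add: rcis_cmod_Arg chart_inf_eq z_def)
  ultimately show ?thesis
    by (simp add: chart_fin_mem_Omega)
qed

lemma continuous_map_chart_fin:
  "continuous_map (top_of_set (dom_fin n \<alpha>)) (Omega_top n \<alpha>) chart_fin"
  using n_ge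
  by (auto simp: continuous_map_def topspace_Omega_top chart_fin_mem_Omega openin_Omega_top
      Omega_openin_def openin_open_eq[OF open_dom_fin])

lemma continuous_map_chart_inf:
  "continuous_map (top_of_set dom_inf) (Omega_top n \<alpha>) chart_inf"
proof -
  have "open dom_inf"
    by (simp add: dom_inf_def)
  then show ?thesis
    using n_ge
    by (auto simp: continuous_map_def topspace_Omega_top chart_inf_mem_Omega openin_Omega_top
        Omega_openin_def openin_open_eq)
qed

lemma continuous_map_from_Omega:
  fixes F :: "ext_point \<Rightarrow> real^3"
  assumes "continuous_on (dom_fin n \<alpha>) (F \<circ> chart_fin)" "continuous_on dom_inf (F \<circ> chart_inf)"
  shows "continuous_map (Omega_top n \<alpha>) euclidean F"
proof -
  have "Omega_openin n \<alpha> {x \<in> Omega n \<alpha>. F x \<in> V}" if "open V" for V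
  proof -
    have "{p \<in> dom_fin n \<alpha>. chart_fin p \<in> {x \<in> Omega n \<alpha>. F x \<in> V}} = dom_fin n \<alpha> \<inter> (F \<circ> chart_fin) -` V"
      "{p \<in> dom_inf. chart_inf p \<in> {x \<in> Omega n \<alpha>. F x \<in> V}} = dom_inf \<inter> (F \<circ> chart_inf) -` V"
      by (auto simp: chart_fin_mem_Omega chart_inf_mem_Omega)
    moreover have "open (dom_fin n \<alpha> \<inter> (F \<circ> chart_fin) -` V)"
      by (rule continuous_open_preimage[OF assms(1) open_dom_fin that])
    moreover have "open (dom_inf \<inter> (F \<circ> chart_inf) -` V)"
      by (rule continuous_open_preimage[OF assms(2) _ that]) (simp add: dom_inf_def)
    ultimately show ?thesis
      unfolding Omega_openin_def by (simp only:) auto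
  qed
  then show ?thesis
    using n_ge by (simp add: continuous_map_def topspace_Omega_top openin_Omega_top)
qed

text \<open>Reduces properness to the plane: one piece comes from a bounded part of
  \<open>dom_fin\<close>, the other from a compact subset of \<open>dom_inf\<close>. Escape to the
  boundary is thus possible only in the first chart.\<close>

lemma Omega_cover:
  assumes "x \<in> Omega n \<alpha>"
  obtains u \<theta> where "(u, \<theta>) \<in> dom_fin n \<alpha>" "u \<in> {-1..2}" "\<theta> \<in> {0..2 * pi}" "x = chart_fin (u, \<theta>)"
    | p where "p \<in> cball 0 (1 / 2)" "x = chart_inf p"
proof (cases x)
  case P_inf
  then have "x = chart_inf 0"
    by (simp add: chart_inf_eq iota_def complex_eq_iff)
  then show ?thesis
    using that(2)[of 0] by simp
next
  case (Pt u a)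
  have "\<exists>\<phi>. a = angle_of \<phi>"
    by (induction a rule: angle.abs_induct) auto
  then obtain \<phi> where "a = angle_of \<phi>" ..
  obtain k :: int where k: "0 \<le> \<phi> - 2 * pi * of_int k" "\<phi> - 2 * pi * of_int k < 2 * pi"
    by (rule angle_mod_2pi)
  define \<theta> where "\<theta> = \<phi> - 2 * pi * of_int k"
  have \<theta>: "\<theta> \<in> {0..2 * pi}"
    using k by (simp add: \<theta>_def)
  have "angle_of \<phi> = angle_of \<theta>"
    by (auto simp: angle.abs_eq_iff \<theta>_def)
  then have x: "x = chart_fin (u, \<theta>)"
    using Pt \<open>a = angle_of \<phi>\<close> by (simp add: chart_fin_def)
  then have dom: "(u, \<theta>) \<in> dom_fin n \<alpha>"
    using assms by (simp add: chart_fin_mem_Omega)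
  show ?thesis
  proof (cases "u \<le> 2")
    case True
    have "cos (\<theta> - \<alpha> 0) < u"
      using dom n_ge by (auto simp: mem_dom_fin)
    then have "- 1 \<le> u"
      using cos_ge_minus_one[of "\<theta> - \<alpha> 0"] by linarith
    then show ?thesis
      using that(1) True \<theta> dom x by auto
  next
    case False
    then have "u > 1"
      by simp
    then obtain r where r: "0 < r" "(r + inverse r) / 2 = u" "r < inverse u"
      by (rule radius_of_height)
    have "inverse u < 1 / 2"
      using False by (simp add: field_simps)
    define p where "p = (Re (rcis r \<theta>), Im (rcis r \<theta>))"
    have z: "Complex (fst p) (snd p) = rcis r \<theta>"
      by (simp only: p_def fst_conv snd_conv complex_surj)
    have "norm p \<le> 1 / 2"
      using norm_Complex_pair[of p] r \<open>inverse u < 1 / 2\<close> unfolding z by simp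
    moreover have "x = chart_inf p"
      using r iota_rcis[of r \<theta>] by (simp add: x chart_inf_eq z)
    ultimately show ?thesis
      using that(2)[of p] by simp
  qed
qed

text \<open>At the limit \<open>u\<close> is the maximum of the cosines. The logarithms of the ends
  in \<open>J\<close>, where it is attained, diverge, and the others converge. A linear functional
  that kills \<open>dir j\<close> for all \<open>j\<close> in \<open>J\<close> except
  \<open>j0\<close> leaves a single divergent term, which nothing can cancel.\<close>

lemma log_sum_unbounded_near_boundary:
  assumes dom: "\<And>k :: nat. X k \<in> dom_fin n \<alpha>" and lim: "X \<longlonglongrightarrow> (u, \<theta>)"
    and bdry: "(u, \<theta>) \<notin> dom_fin n \<alpha>"
  shows "\<not> Bseq (\<lambda>k. log_sum (X k))"
proof
  assume Bseq: "Bseq (\<lambda>k. log_sum (X k))"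
  define d where "d j k = fst (X k) - cos (snd (X k) - \<alpha> j)" for j k
  have d_pos: "d j k > 0" if "j < 2 * n" for j k
    using dom[of k] that by (cases "X k") (auto simp: d_def mem_dom_fin)
  have "(\<lambda>k. fst (X k)) \<longlonglongrightarrow> u" "(\<lambda>k. snd (X k)) \<longlonglongrightarrow> \<theta>"
    using tendsto_fst[OF lim] tendsto_snd[OF lim] by simp_all
  then have d_lim: "d j \<longlonglongrightarrow> u - cos (\<theta> - \<alpha> j)" for j
    unfolding d_def[abs_def] by (intro tendsto_intros)
  have le_u: "cos (\<theta> - \<alpha> j) \<le> u" if "j < 2 * n" for j
    using LIMSEQ_le_const[OF d_lim[of j], of 0] d_pos[OF that] by (auto intro: less_imp_le)
  define J where "J = {j. j < 2 * n \<and> cos (\<theta> - \<alpha> j) = u}"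
  obtain j0 where j0: "j0 < 2 * n" "cos (\<theta> - \<alpha> j0) = u"
    using bdry le_u by (auto simp: mem_dom_fin not_less dest: order_antisym)
  have cnj: "cis (\<theta> - \<alpha> j) = cnj (cis (\<theta> - \<alpha> j0))" if "j \<in> J" "j \<noteq> j0" for j
  proof -
    have "(sin (\<theta> - \<alpha> j))\<^sup>2 = (sin (\<theta> - \<alpha> j0))\<^sup>2"
      using that j0 by (simp add: J_def sin_squared_eq)
    then have "cis (\<theta> - \<alpha> j) = cis (\<theta> - \<alpha> j0) \<or> ?thesis"
      using that j0 by (auto simp: J_def complex_eq_iff power2_eq_iff)
    moreover have "pole j \<noteq> pole j0"
      using inj_on_pole that j0 by (auto simp: J_def inj_on_def)
    ultimately show ?thesis
      by (auto simp flip: cis_divide)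
  qed
  \<comment> \<open>At most two logarithms blow up, those of the two ends at equal angular distance from \<open>\<theta>\<close>;
    a linear functional with value \<open>pole j ^ (n - 1) - e\<close> on \<open>dir j\<close> isolates one of them.\<close>
  obtain e where e: "pole j0 ^ (n - 1) \<noteq> e" "\<And>j. j \<in> J - {j0} \<Longrightarrow> pole j ^ (n - 1) = e"
  proof (cases "J - {j0} = {}")
    case True
    then show ?thesis
      \<comment> \<open>Any value other than the nonzero number \<open>pole j0 ^ (n - 1)\<close>
        would do.\<close>
      using that[of 0] by auto
  next
    case False
    then obtain j1 where j1: "j1 \<in> J" "j1 \<noteq> j0"
      by auto
    have "pole j = pole j1" if "j \<in> J - {j0}" for j
    proof -
      have "cis (\<theta> - \<alpha> j) = cis (\<theta> - \<alpha> j1)"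
        using cnj[of j] cnj[OF j1] that by simp
      then show ?thesis
        by (auto simp flip: cis_divide)
    qed
    moreover have "pole j0 ^ (n - 1) \<noteq> pole j1 ^ (n - 1)"
    proof
      assume "pole j0 ^ (n - 1) = pole j1 ^ (n - 1)"
      then have "cis (\<theta> - \<alpha> j0) ^ (n - 1) = cis (\<theta> - \<alpha> j1) ^ (n - 1)"
        by (simp add: power_divide flip: cis_divide)
      then have "cis (\<theta> - \<alpha> j0) = cnj (cis (\<theta> - \<alpha> j0))"
        using cnj[OF j1] le_u j0 by (intro power_eq_cnj_power_imp_real[of _ \<theta>]) auto
      then have "cis (\<theta> - \<alpha> j0) = cis (\<theta> - \<alpha> j1)"
        using cnj[OF j1] by simp
      then have "pole j0 = pole j1"
        by (auto simp flip: cis_divide)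
      then show False
        using inj_on_pole j0 j1 by (auto simp: J_def inj_on_def)
    qed
    ultimately show ?thesis
      using that[of "pole j1 ^ (n - 1)"] by auto
  qed
  define L where "L v = of_real (v $ 2) + \<i> * of_real (v $ 3) + e * of_real (v $ 1)" for v :: "real^3"
  have L: "bounded_linear L"
    by (intro linear_conv_bounded_linear[THEN iffD1] linearI)
      (auto simp: L_def complex_eq_iff algebra_simps)
  have L_dir: "L (dir j) = pole j ^ (n - 1) - e" for j
    by (simp add: L_def dir_def Complex.DeMoivre complex_eq_iff)
  have L_sum: "L (log_sum p) = (\<Sum>j<2 * n. (weight j * ln (fst p - cos (snd p - \<alpha> j))) *\<^sub>R L (dir j))" for p
    by (simp add: log_sum_def linear_sum[OF bounded_linear.linear[OF L]]
        linear_scale[OF bounded_linear.linear[OF L]])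
  define R where "R k = (\<Sum>j\<in>{..<2 * n} - J. (weight j * ln (d j k)) *\<^sub>R L (dir j))" for k
  have "convergent R"
  proof -
    have "(\<lambda>k. (weight j * ln (d j k)) *\<^sub>R L (dir j)) \<longlonglongrightarrow>
        (weight j * ln (u - cos (\<theta> - \<alpha> j))) *\<^sub>R L (dir j)" if "j \<in> {..<2 * n} - J" for j
      using that le_u[of j] d_lim by (intro tendsto_intros) (auto simp: J_def)
    then show ?thesis
      unfolding R_def[abs_def] by (rule convergentI[OF tendsto_sum])
  qed
  then have "Bseq R"
    by (rule convergent_imp_Bseq)
  define c where "c = weight j0 *\<^sub>R L (dir j0)"
  have "c \<noteq> 0"
    using weight_nonzero[OF j0(1)] e(1) by (simp add: c_def L_dir)
  have "ln (d j0 k) *\<^sub>R c = L (log_sum (X k)) - R k" for k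
  proof -
    have "L (log_sum (X k)) = (\<Sum>j<2 * n. (weight j * ln (d j k)) *\<^sub>R L (dir j))"
      by (simp add: L_sum d_def)
    also have "\<dots> = R k + (\<Sum>j\<in>J. (weight j * ln (d j k)) *\<^sub>R L (dir j))"
      unfolding R_def by (intro sum.subset_diff) (auto simp: J_def)
    also have "(\<Sum>j\<in>J. (weight j * ln (d j k)) *\<^sub>R L (dir j)) = (\<Sum>j\<in>{j0}. (weight j * ln (d j k)) *\<^sub>R L (dir j))"
      using j0 e(2) by (intro sum.mono_neutral_right) (auto simp: J_def L_dir)
    finally show ?thesis
      by (simp add: c_def mult.commute)
  qed
  moreover have "Bseq (\<lambda>k. L (log_sum (X k)) - R k)"
  proof -
    obtain K0 K1 K2 where "K0 > 0" "\<And>v. norm (L v) \<le> norm v * K0"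
      "\<And>k. norm (log_sum (X k)) \<le> K1" "\<And>k. norm (R k) \<le> K2"
      using bounded_linear.pos_bounded[OF L] Bseq \<open>Bseq R\<close> by (auto elim!: BseqE)
    then have "norm (L (log_sum (X k))) \<le> K1 * K0" "norm (R k) \<le> K2" for k
      by (meson less_imp_le mult_right_mono order_trans)+
    then show ?thesis
      by (intro BseqI'[of _ "K1 * K0 + K2"] norm_triangle_le_diff add_mono)
  qed
  ultimately obtain K where K: "\<And>k. norm (ln (d j0 k) *\<^sub>R c) \<le> K"
    by (auto elim!: BseqE)
  have "filterlim (d j0) (at_right 0) sequentially"
    using d_lim[of j0] j0 d_pos by (intro tendsto_imp_filterlim_at_right) auto
  then have "filterlim (\<lambda>k. ln (d j0 k)) at_bot sequentially"
    by (rule filterlim_compose[OF ln_at_0])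
  then have "eventually (\<lambda>k. ln (d j0 k) \<le> - (K / norm c) - 1) sequentially"
    by (simp add: filterlim_at_bot)
  then obtain k where "ln (d j0 k) \<le> - (K / norm c) - 1"
    by (auto simp: eventually_sequentially)
  moreover have "\<bar>ln (d j0 k)\<bar> \<le> K / norm c"
    using K[of k] \<open>c \<noteq> 0\<close> by (simp add: field_simps)
  ultimately show False
    by linarith
qed

text \<open>The first chart uses the explicit logarithms. The second, needed at
  \<open>P_inf\<close>, uses the Weierstrass data of \<open>f\<close>, since
  \<open>cmod (g z) < 1\<close> on the open disk.\<close>

lemma immersion_of_extension:
  assumes f: "kobayashi_surface n \<alpha> f" and F: "analytic_extension n \<alpha> f F"
  shows "injective_differential_on (F \<circ> chart_fin) (dom_fin n \<alpha>)"
    and "injective_differential_on (F \<circ> chart_inf) dom_inf"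
proof -
  obtain C where C: "\<And>p. p \<in> dom_fin n \<alpha> \<Longrightarrow> (F \<circ> chart_fin) p = log_sum p + C"
    using extension_on_chart_fin[OF f F] by blast
  show "injective_differential_on (F \<circ> chart_fin) (dom_fin n \<alpha>)"
    unfolding injective_differential_on_def
  proof
    fix p assume p: "p \<in> dom_fin n \<alpha>"
    obtain u \<theta> where u\<theta>: "p = (u, \<theta>)"
      by force
    let ?D = "\<lambda>p. \<Sum>j<2 * n.
      (weight j * ((fst p + snd p * sin (\<theta> - \<alpha> j)) / (u - cos (\<theta> - \<alpha> j)))) *\<^sub>R dir j"
    have D: "(log_sum has_derivative ?D) (at p)"
      using log_sum_has_derivative p unfolding u\<theta> by blast
    then have "((\<lambda>p. log_sum p + C) has_derivative ?D) (at p)"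
      by (rule has_derivative_add_const)
    then have "(F \<circ> chart_fin has_derivative ?D) (at p)"
      by (rule has_derivative_transform_within_open[OF _ open_dom_fin p]) (rule C[symmetric])
    moreover have "inj ?D"
      unfolding linear_injective_0[OF has_derivative_linear[OF D]]
    proof (intro allI impI)
      fix v assume "?D v = 0"
      then have "fst v = 0 \<and> snd v = 0"
        by (rule log_sum_differential_injective[OF p[unfolded u\<theta>]])
      then show "v = 0"
        by (simp add: prod_eq_iff)
    qed
    ultimately show "\<exists>D. (F \<circ> chart_fin has_derivative D) (at p) \<and> inj D"
      by blast
  qed
  show "injective_differential_on (F \<circ> chart_inf) dom_inf"
    unfolding injective_differential_on_def
  proof
    fix p assume p: "p \<in> dom_inf"
    let ?z = "\<lambda>p. Complex (fst p) (snd p)"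
    let ?W = "Re_form (weierstrass_form (kob_g n) (kob_omega n \<alpha>) (?z p))"
    have norm: "cmod (?z q) < 1" if "q \<in> dom_inf" for q
      using that by (simp add: norm_Complex_pair dom_inf_def)
    have "((\<lambda>z. f (Fin z)) has_derivative ?W) (at (?z p))"
      using f not_end_if_cmod_less_1[OF norm[OF p]] by (simp add: kobayashi_surface_def maxface_on_sphere_def)
    with bounded_linear_imp_has_derivative[OF bounded_linear_Complex]
    have "((\<lambda>p. f (Fin (?z p))) has_derivative (\<lambda>d. ?W (?z d))) (at p)"
      by (rule has_derivative_compose)
    moreover have "f (Fin (?z q)) = (F \<circ> chart_inf) q" if "q \<in> dom_inf" for q
      using F norm[OF that] not_end_if_cmod_less_1[OF norm[OF that]]
      by (simp add: analytic_extension_def chart_inf_eq)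
    moreover have "open dom_inf"
      by (simp add: dom_inf_def)
    ultimately have "(F \<circ> chart_inf has_derivative (\<lambda>d. ?W (?z d))) (at p)"
      using p by (auto intro: has_derivative_transform_within_open)
    moreover have "inj (\<lambda>d. ?W (?z d))"
    proof -
      have "cmod (kob_g n (?z p)) < 1"
        using norm[OF p] n_ge by (simp add: kob_g_def norm_power power_less_one_iff)
      moreover have "kob_omega n \<alpha> (?z p) \<noteq> 0"
        using not_end_if_cmod_less_1[OF norm[OF p]] by (auto simp: kob_omega_def kob_Lambda_def kob_ends_def)
      ultimately have "inj ?W"
        by (rule inj_Re_weierstrass_form)
      moreover have "inj ?z"
        by (auto simp: inj_on_def prod_eq_iff)
      ultimately have "inj (?W \<circ> ?z)"
        by (rule inj_compose)
      then show ?thesis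
        by (simp add: o_def)
    qed
    ultimately show "\<exists>D. (F \<circ> chart_inf has_derivative D) (at p) \<and> inj D"
      by blast
  qed
qed

text \<open>Since \<open>real^3\<close> is a Hausdorff k-space, it suffices that preimages of
  compact sets are compact. Such a preimage is the union of the chart images of two compact planar
  sets \<open>S\<close> and \<open>T\<close>.\<close>

lemma proper_extension:
  assumes f: "kobayashi_surface n \<alpha> f" and F: "analytic_extension n \<alpha> f F"
  shows "proper_map (Omega_top n \<alpha>) euclidean F"
proof (rule compact_imp_proper_map)
  have diff_cont: "continuous_on U h" if "injective_differential_on h U" for h :: "real \<times> real \<Rightarrow> real^3" and U
    using that unfolding injective_differential_on_def
    by (meson continuous_at_imp_continuous_on has_derivative_continuous)
  have cont: "continuous_on (dom_fin n \<alpha>) (F \<circ> chart_fin)" "continuous_on dom_inf (F \<circ> chart_inf)"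
    using immersion_of_extension[OF f F] diff_cont by blast+
  then show "continuous_map (Omega_top n \<alpha>) euclidean F \<or> kc_space (Omega_top n \<alpha>)"
    by (simp add: continuous_map_from_Omega)
  obtain C where C: "\<And>p. p \<in> dom_fin n \<alpha> \<Longrightarrow> (F \<circ> chart_fin) p = log_sum p + C"
    using extension_on_chart_fin[OF f F] by blast
  fix K :: "(real^3) set" assume "compactin euclidean K"
  then have "compact K"
    by simp
  define S where "S = {p \<in> dom_fin n \<alpha>. p \<in> {-1..2} \<times> {0..2 * pi} \<and> F (chart_fin p) \<in> K}"
  define T where "T = {p \<in> cball 0 (1 / 2). F (chart_inf p) \<in> K}"
  have "compact S"
  proof -
    have "bounded S"
      by (rule bounded_subset[OF bounded_Times[of "{-1..2::real}" "{0..2 * pi}"]]) (auto simp: S_def)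
    \<comment> \<open>The only danger is a limit on the boundary of \<open>dom_fin\<close>; there
      \<open>log_sum\<close> would be unbounded, whereas on \<open>S\<close> it stays in a translate
      of \<open>K\<close>.\<close>
    moreover have "closed S"
      unfolding closed_sequential_limits
    proof (intro allI impI, elim conjE)
      fix X l assume X: "\<forall>k. X k \<in> S" and lim: "X \<longlonglongrightarrow> l"
      have "closed ({-1..2::real} \<times> {0..2 * pi})"
        by (intro closed_Times) auto
      then have box: "l \<in> {-1..2} \<times> {0..2 * pi}"
        by (rule closed_sequentially[OF _ _ lim]) (use X in \<open>auto simp: S_def\<close>)
      have dom: "X k \<in> dom_fin n \<alpha>" for k
        using X by (simp add: S_def)
      have "l \<in> dom_fin n \<alpha>"
      proof (rule ccontr)
        assume "l \<notin> dom_fin n \<alpha>"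
        then have "\<not> Bseq (\<lambda>k. log_sum (X k))"
          using log_sum_unbounded_near_boundary[OF dom] lim by (cases l) auto
        moreover have "range (\<lambda>k. log_sum (X k)) \<subseteq> (\<lambda>v. v - C) ` K"
        proof safe
          fix k
          have "log_sum (X k) = F (chart_fin (X k)) - C"
            using C[OF dom[of k]] by simp
          then show "log_sum (X k) \<in> (\<lambda>v. v - C) ` K"
            using X by (auto simp: S_def)
        qed
        moreover have "bounded ((\<lambda>v. v - C) ` K)"
          using \<open>compact K\<close> by (intro compact_imp_bounded compact_continuous_image continuous_intros)
        ultimately show False
          by (meson Bseq_eq_bounded bounded_subset)
      qed
      moreover have "F (chart_fin l) \<in> K"
      proof (rule closed_sequentially[OF compact_imp_closed[OF \<open>compact K\<close>]])
        show "F (chart_fin (X k)) \<in> K" for k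
          using X by (simp add: S_def)
        show "(\<lambda>k. F (chart_fin (X k))) \<longlonglongrightarrow> F (chart_fin l)"
          using continuous_on_tendsto_compose[OF cont(1) lim \<open>l \<in> dom_fin n \<alpha>\<close>] dom by simp
      qed
      ultimately show "l \<in> S"
        using box by (simp add: S_def)
    qed
    ultimately show ?thesis
      by (simp add: compact_eq_bounded_closed)
  qed
  have sub: "cball 0 (1 / 2) \<subseteq> dom_inf"
    by (auto simp: dom_inf_def)
  have "compact T"
  proof -
    have "T = cball 0 (1 / 2) \<inter> (F \<circ> chart_inf) -` K"
      by (auto simp: T_def)
    moreover have "closed (cball 0 (1 / 2) \<inter> (F \<circ> chart_inf) -` K)"
      using continuous_on_subset[OF cont(2) sub] compact_imp_closed[OF \<open>compact K\<close>]
      by (intro continuous_closed_preimage) auto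
    ultimately show ?thesis
      by (auto simp: compact_eq_bounded_closed intro: bounded_subset[OF bounded_cball])
  qed
  have "compactin (Omega_top n \<alpha>) (chart_fin ` S)"
    using \<open>compact S\<close> by (intro image_compactin[OF _ continuous_map_chart_fin])
      (auto simp: compactin_subtopology S_def)
  moreover have "compactin (Omega_top n \<alpha>) (chart_inf ` T)"
    using \<open>compact T\<close> sub by (intro image_compactin[OF _ continuous_map_chart_inf])
      (auto simp: compactin_subtopology T_def)
  ultimately have "compactin (Omega_top n \<alpha>) (chart_fin ` S \<union> chart_inf ` T)"
    by (rule compactin_Un)
  moreover have "{x \<in> Omega n \<alpha>. F x \<in> K} = chart_fin ` S \<union> chart_inf ` T"
  proof (intro equalityI subsetI)
    fix x assume "x \<in> {x \<in> Omega n \<alpha>. F x \<in> K}"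
    then have "x \<in> Omega n \<alpha>" "F x \<in> K"
      by auto
    then show "x \<in> chart_fin ` S \<union> chart_inf ` T"
      by (elim Omega_cover) (auto simp: S_def T_def)
  next
    fix x assume "x \<in> chart_fin ` S \<union> chart_inf ` T"
    then show "x \<in> {x \<in> Omega n \<alpha>. F x \<in> K}"
      using sub by (auto simp: S_def T_def chart_fin_mem_Omega chart_inf_mem_Omega)
  qed
  ultimately show "compactin (Omega_top n \<alpha>) {x \<in> topspace (Omega_top n \<alpha>). F x \<in> K}"
    using n_ge by (simp add: topspace_Omega_top)
qed (auto simp: k_space_euclideanreal Hausdorff_imp_kc_space)

end

theorem proposition5p2:
  fixes n :: nat and \<alpha> :: "nat \<Rightarrow> real"
    and f :: "riemann_sphere \<Rightarrow> real^3" and F :: "ext_point \<Rightarrow> real^3"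
  assumes "n \<ge> 2"
    and "\<alpha> 0 = 0"
    and "\<And>j. j < 2 * n - 1 \<Longrightarrow> \<alpha> j < \<alpha> (j + 1)"
    and "\<alpha> (2 * n - 1) < 2 * pi"
    and "\<alpha> (2 * n) = 2 * pi"
    and "kobayashi_surface n \<alpha> f"
    and "\<And>j. j \<le> 2 * n - 1 \<Longrightarrow> \<bar>\<alpha> j - \<alpha> (j + 1)\<bar> < 2 * pi / (real n - 1)"
    and "analytic_extension n \<alpha> f F"
  shows "analytic_immersion_on_Omega n \<alpha> F \<and> proper_map (Omega_top n \<alpha>) euclidean F"
proof -
  interpret kobayashi_data n \<alpha>
  proof
    fix j assume j: "j < 2 * n"
    show "\<alpha> j < \<alpha> (Suc j)"
    proof (cases "j < 2 * n - 1")
      case True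
      then show ?thesis
        using assms(3) by simp
    next
      case False
      then have "j = 2 * n - 1" "Suc j = 2 * n"
        using j by auto
      then show ?thesis
        using assms(4,5) by simp
    qed
    show "\<alpha> (Suc j) - \<alpha> j < 2 * pi / (real n - 1)"
      using assms(7)[of j] j by (simp add: abs_less_iff)
  qed (use assms in auto)
  show ?thesis
    using assms(6,8) immersion_of_extension proper_extension
    by (auto simp: analytic_immersion_on_Omega_def analytic_extension_def)
qed

end
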